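(* Let $\alpha \in (0,1)$ and let $A$ be the generator of the right shift $C_0$-semigroup $(S(t))_{t\ge 0}$ on $L^2(\mathbb{R}_+)$ given by $$(S(t)f)(\tau) = \begin{cases} f(\tau-t), & \tau \geq t,\\ 0, & \tau < t,\end{cases} \qquad f \in L^2(\mathbb{R}_+).$$ Then there exists $C \in \mathcal{L}(D(A),\mathbb{C})$ satisfying $$\sup_{\lambda \in \mathbb{C}_+} (\mathrm{Re}\, \lambda)^{\frac{1-\alpha}{2}} \|C R(\lambda,A)\|_{L^2(\mathbb{R}_+)^*} < \infty,$$ but for which $C$ is not (continuous) $\alpha$-admissible for $A$, i.e. there is no constant $M>0$ such that $$\int_0^\infty t^\alpha |C S(t)x_0|^2 \, dt \leq M^2 \|x_0\|_{L^2(\mathbb{R}_+)}^2 \quad \text{for all } x_0 \in D(A).$$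
   Context: $\mathbb{R}_+ = [0,\infty)$, $\mathbb{C}_+ = \{\lambda \in \mathbb{C} : \mathrm{Re}\,\lambda > 0\}$, and $L^2(\mathbb{R}_+)$ consists of complex-valued functions. $D(A)$ is the domain of $A$ equipped with the graph norm, $\mathcal{L}(D(A),\mathbb{C})$ is the space of bounded linear functionals on $D(A)$ with respect to this norm, and $R(\lambda,A) = (\lambda I - A)^{-1}$. The norm $\|\cdot\|_{L^2(\mathbb{R}_+)^*}$ is the norm of a bounded linear functional on $L^2(\mathbb{R}_+)$. *)

theory Defs
  imports "HOL-Analysis.Analysis"
begin

definition half_line :: "real measure"
  where "half_line = restrict_space lborel {0..}"

definition sq_integrable :: "(real \<Rightarrow> complex) \<Rightarrow> bool"
  where "sq_integrable f \<longleftrightarrow>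
    f \<in> borel_measurable half_line \<and> integrable half_line (\<lambda>x. (cmod (f x))\<^sup>2)"

definition l2_eq :: "(real \<Rightarrow> complex) \<Rightarrow> (real \<Rightarrow> complex) \<Rightarrow> bool"
  where "l2_eq f g \<longleftrightarrow> sq_integrable f \<and> sq_integrable g \<and> (AE x in half_line. f x = g x)"

lemma sq_integrable_measurable [measurable_dest]:
  "sq_integrable f \<Longrightarrow> f \<in> borel_measurable half_line"
  by (simp add: sq_integrable_def)

lemma sq_integrable_zero: "sq_integrable (\<lambda>x. 0)"
  by (simp add: sq_integrable_def)

lemma sq_integrable_add:
  assumes "sq_integrable f" "sq_integrable g"
  shows "sq_integrable (\<lambda>x. f x + g x)"
proof -
  have bd: "(cmod (f x + g x))\<^sup>2 \<le> 2 * (cmod (f x))\<^sup>2 + 2 * (cmod (g x))\<^sup>2" for x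
  proof -
    have "(cmod (f x + g x))\<^sup>2 \<le> (cmod (f x) + cmod (g x))\<^sup>2"
      by (intro power_mono norm_triangle_ineq) auto
    also have "\<dots> \<le> 2 * (cmod (f x))\<^sup>2 + 2 * (cmod (g x))\<^sup>2"
      using sum_squares_bound[of "cmod (f x)" "cmod (g x)"] by (simp add: power2_sum)
    finally show ?thesis .
  qed
  have "integrable half_line (\<lambda>x. (cmod (f x + g x))\<^sup>2)"
    by (rule Bochner_Integration.integrable_bound
          [where f = "\<lambda>x. 2 * (cmod (f x))\<^sup>2 + 2 * (cmod (g x))\<^sup>2"])
       (use assms bd in \<open>auto simp: sq_integrable_def\<close>)
  then show ?thesis
    using assms by (auto simp: sq_integrable_def)
qed

lemma sq_integrable_scaleC:
  "sq_integrable f \<Longrightarrow> sq_integrable (\<lambda>x. c * f x)"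
  by (auto simp: sq_integrable_def norm_mult power_mult_distrib)

lemma sq_integrable_scaleR:
  "sq_integrable f \<Longrightarrow> sq_integrable (\<lambda>x. c *\<^sub>R f x)"
  unfolding scaleR_conv_of_real by (rule sq_integrable_scaleC)

lemma sq_integrable_uminus:
  "sq_integrable f \<Longrightarrow> sq_integrable (\<lambda>x. - f x)"
  by (auto simp: sq_integrable_def)

lemma sq_integrable_diff:
  "sq_integrable f \<Longrightarrow> sq_integrable g \<Longrightarrow> sq_integrable (\<lambda>x. f x - g x)"
  using sq_integrable_add[of f "\<lambda>x. - g x"] sq_integrable_uminus[of g] by simp

lemma integrable_inner_sq:
  assumes "sq_integrable f" "sq_integrable g"
  shows "integrable half_line (\<lambda>x. f x \<bullet> g x)"
proof (rule Bochner_Integration.integrable_bound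
    [where f = "\<lambda>x. (cmod (f x))\<^sup>2 + (cmod (g x))\<^sup>2"])
  show "integrable half_line (\<lambda>x. (cmod (f x))\<^sup>2 + (cmod (g x))\<^sup>2)"
    using assms by (auto simp: sq_integrable_def)
  show "(\<lambda>x. f x \<bullet> g x) \<in> borel_measurable half_line"
    using assms by (auto simp: sq_integrable_def)
  have "\<bar>f x \<bullet> g x\<bar> \<le> (cmod (f x))\<^sup>2 + (cmod (g x))\<^sup>2" for x
    using Cauchy_Schwarz_ineq2[of "f x" "g x"] sum_squares_bound[of "cmod (f x)" "cmod (g x)"]
      mult_nonneg_nonneg[of "cmod (f x)" "cmod (g x)"]
    by simp
  then show "AE x in half_line. norm (f x \<bullet> g x) \<le> norm ((cmod (f x))\<^sup>2 + (cmod (g x))\<^sup>2)"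
    by simp
qed

lemma sq_integrable_iff_lborel:
  "sq_integrable f \<longleftrightarrow>
     (\<lambda>x. indicator {0..} x *\<^sub>R f x) \<in> borel_measurable lborel \<and>
     integrable lborel (\<lambda>x. (cmod (indicator {0..} x *\<^sub>R f x))\<^sup>2)"
proof -
  have "(\<lambda>x. (cmod (indicator {0..} x *\<^sub>R f x))\<^sup>2) = (\<lambda>x. indicator {0..} x *\<^sub>R (cmod (f x))\<^sup>2)"
    by (auto simp: indicator_def)
  then show ?thesis
    by (simp add: sq_integrable_def half_line_def borel_measurable_restrict_space_iff
        integrable_restrict_space)
qed

lemma AE_half_line_iff: "(AE x in half_line. P x) \<longleftrightarrow> (AE x in lborel. 0 \<le> x \<longrightarrow> P x)"
  unfolding half_line_def by (subst AE_restrict_space_iff) auto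

lemma sq_integrable_shift:
  assumes "sq_integrable f"
  shows "sq_integrable (\<lambda>x. if t \<le> x then f (x - t) else 0)"
proof -
  define F where "F = (\<lambda>x. indicator {0..} x *\<^sub>R f x)"
  have F: "F \<in> borel_measurable borel" "integrable lborel (\<lambda>x. (cmod (F x))\<^sup>2)"
    using assms by (auto simp: sq_integrable_iff_lborel F_def)
  have "integrable lborel (\<lambda>x. (cmod (F (x - t)))\<^sup>2)"
    using lborel_integrable_real_affine[OF F(2), of 1 "- t"] by simp
  then have "integrable lborel (\<lambda>x. indicator {0..} x *\<^sub>R (cmod (F (x - t)))\<^sup>2)"
    by (intro integrable_mult_indicator) auto
  also have "(\<lambda>x. indicator {0..} x *\<^sub>R (cmod (F (x - t)))\<^sup>2) =
      (\<lambda>x. (cmod (indicator {0..} x *\<^sub>R F (x - t)))\<^sup>2)"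
    by (auto simp: indicator_def)
  finally have int: "integrable lborel (\<lambda>x. (cmod (indicator {0..} x *\<^sub>R F (x - t)))\<^sup>2)" .
  have ext: "(\<lambda>x. indicator {0..} x *\<^sub>R F (x - t)) =
      (\<lambda>x. indicator {0..} x *\<^sub>R (if t \<le> x then f (x - t) else 0))"
    by (auto simp: F_def indicator_def fun_eq_iff)
  have int': "integrable lborel
      (\<lambda>x. (cmod (indicator {0..} x *\<^sub>R (if t \<le> x then f (x - t) else 0)))\<^sup>2)"
    using int unfolding fun_cong[OF ext] .
  have "(\<lambda>x. indicator {0..} x *\<^sub>R F (x - t)) \<in> borel_measurable lborel"
    using F(1) by measurable
  then show ?thesis
    using int' unfolding sq_integrable_iff_lborel ext by blast
qed

lemma AE_shift:
  assumes f: "sq_integrable f" and g: "sq_integrable g"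
    and eq: "AE x in half_line. f x = g x"
  shows "AE x in half_line. (if t \<le> x then f (x - t) else 0) = (if t \<le> x then g (x - t) else 0)"
proof -
  define F where "F = (\<lambda>x. indicator {0..} x *\<^sub>R f x)"
  define G where "G = (\<lambda>x. indicator {0..} x *\<^sub>R g x)"
  have [measurable]: "F \<in> borel_measurable borel" "G \<in> borel_measurable borel"
    using f g by (auto simp: sq_integrable_iff_lborel F_def G_def)
  have "AE x in lborel. 0 \<le> x \<longrightarrow> f x = g x"
    using eq by (simp add: AE_half_line_iff)
  then have "AE x in lborel. F x = G x"
    by (rule eventually_mono) (auto simp: F_def G_def indicator_def)
  then have "AE x in lborel. F (- t + 1 * x) = G (- t + 1 * x)"
    by (intro AE_borel_affine) auto
  then have "AE x in lborel. F (x - t) = G (x - t)"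
    by simp
  then have "AE x in lborel. 0 \<le> x \<longrightarrow>
      (if t \<le> x then f (x - t) else 0) = (if t \<le> x then g (x - t) else 0)"
    by (rule eventually_mono) (auto simp: F_def G_def indicator_def)
  then show ?thesis
    by (simp add: AE_half_line_iff)
qed

(* L2(R_+): square-integrable representatives modulo almost everywhere equality. *)
quotient_type l2 = "real \<Rightarrow> complex" / partial: l2_eq
proof (rule part_equivpI)
  show "\<exists>f. l2_eq f f"
    using sq_integrable_zero by (auto simp: l2_eq_def)
  show "symp l2_eq"
    by (auto simp: symp_def l2_eq_def elim: eventually_mono)
  show "transp l2_eq"
    by (auto simp: transp_def l2_eq_def elim: eventually_elim2)
qed

instantiation l2 :: real_inner
begin

lift_definition zero_l2 :: l2 is "\<lambda>x. 0"
  by (simp add: l2_eq_def sq_integrable_zero)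

lift_definition plus_l2 :: "l2 \<Rightarrow> l2 \<Rightarrow> l2" is "\<lambda>f g x. f x + g x"
  by (auto simp: l2_eq_def sq_integrable_add elim: eventually_elim2)

lift_definition minus_l2 :: "l2 \<Rightarrow> l2 \<Rightarrow> l2" is "\<lambda>f g x. f x - g x"
  by (auto simp: l2_eq_def sq_integrable_diff elim: eventually_elim2)

lift_definition uminus_l2 :: "l2 \<Rightarrow> l2" is "\<lambda>f x. - f x"
  by (auto simp: l2_eq_def sq_integrable_uminus elim: eventually_mono)

lift_definition scaleR_l2 :: "real \<Rightarrow> l2 \<Rightarrow> l2" is "\<lambda>c f x. c *\<^sub>R f x"
  by (auto simp: l2_eq_def sq_integrable_scaleR elim: eventually_mono)

(* Real part of the usual complex inner product; it induces the L2 norm. *)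
lift_definition inner_l2 :: "l2 \<Rightarrow> l2 \<Rightarrow> real" is
  "\<lambda>f g. integral\<^sup>L half_line (\<lambda>x. f x \<bullet> g x)"
  by (rule integral_cong_AE) (auto simp: l2_eq_def sq_integrable_def elim: eventually_elim2)

lift_definition norm_l2 :: "l2 \<Rightarrow> real" is
  "\<lambda>f. sqrt (integral\<^sup>L half_line (\<lambda>x. (cmod (f x))\<^sup>2))"
  by (rule arg_cong[where f = sqrt], rule integral_cong_AE)
     (auto simp: l2_eq_def sq_integrable_def elim: eventually_mono)

definition dist_l2 :: "l2 \<Rightarrow> l2 \<Rightarrow> real"
  where "dist_l2 f g = norm (f - g)"

definition sgn_l2 :: "l2 \<Rightarrow> l2"
  where "sgn_l2 f = inverse (norm f) *\<^sub>R f"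

definition uniformity_l2 :: "(l2 \<times> l2) filter"
  where "uniformity_l2 = (INF e\<in>{0 <..}. principal {(x, y). dist x y < e})"

definition open_l2 :: "l2 set \<Rightarrow> bool"
  where "open_l2 U \<longleftrightarrow> (\<forall>x\<in>U. eventually (\<lambda>(x', y). x' = x \<longrightarrow> y \<in> U) uniformity)"

instance
proof
  fix f g h :: l2 and a b :: real
  show "f + g + h = f + (g + h)"
    by transfer (auto simp: l2_eq_def sq_integrable_add add.assoc)
  show "f + g = g + f"
    by transfer (auto simp: l2_eq_def sq_integrable_add add.commute)
  show "0 + f = f"
    by transfer (auto simp: l2_eq_def)
  show "- f + f = 0"
    by transfer (auto simp: l2_eq_def sq_integrable_zero)
  show "f - g = f + - g"
    by transfer (auto simp: l2_eq_def sq_integrable_diff)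
  show "a *\<^sub>R (f + g) = a *\<^sub>R f + a *\<^sub>R g"
    by transfer (auto simp: l2_eq_def scaleR_add_right sq_integrable_add sq_integrable_scaleR)
  show "(a + b) *\<^sub>R f = a *\<^sub>R f + b *\<^sub>R f"
    by transfer (auto simp: l2_eq_def scaleR_add_left sq_integrable_add sq_integrable_scaleR)
  show "a *\<^sub>R b *\<^sub>R f = (a * b) *\<^sub>R f"
    by transfer (auto simp: l2_eq_def sq_integrable_scaleR)
  show "1 *\<^sub>R f = f"
    by transfer (auto simp: l2_eq_def)
  show "dist f g = norm (f - g)"
    by (rule dist_l2_def)
  show "sgn f = inverse (norm f) *\<^sub>R f"
    by (rule sgn_l2_def)
  show "uniformity = (INF e\<in>{0 <..}. principal {(x :: l2, y). dist x y < e})"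
    by (rule uniformity_l2_def)
  show "open U \<longleftrightarrow> (\<forall>x\<in>U. eventually (\<lambda>(x', y). x' = x \<longrightarrow> y \<in> U) uniformity)"
    for U :: "l2 set"
    by (rule open_l2_def)
  show "f \<bullet> g = g \<bullet> f"
    by transfer (simp add: inner_commute)
  show "(f + g) \<bullet> h = f \<bullet> h + g \<bullet> h"
    by transfer (simp add: l2_eq_def inner_add_left integrable_inner_sq)
  show "a *\<^sub>R f \<bullet> g = a * (f \<bullet> g)"
    by transfer simp
  show "0 \<le> f \<bullet> f"
    by transfer simp
  show "f \<bullet> f = 0 \<longleftrightarrow> f = 0"
  proof transfer
    fix f assume "l2_eq f f"
    then have "integrable half_line (\<lambda>x. f x \<bullet> f x)" and f: "sq_integrable f"
      by (auto simp: l2_eq_def integrable_inner_sq)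
    then show "integral\<^sup>L half_line (\<lambda>x. f x \<bullet> f x) = 0 \<longleftrightarrow> l2_eq f (\<lambda>x. 0)"
      by (subst integral_nonneg_eq_0_iff_AE) (auto simp: l2_eq_def sq_integrable_zero)
  qed
  show "norm f = sqrt (f \<bullet> f)"
    by transfer (simp add: power2_norm_eq_inner)
qed

end

lift_definition scaleC :: "complex \<Rightarrow> l2 \<Rightarrow> l2" (infixr "*\<^sub>C" 75) is "\<lambda>c f x. c * f x"
  by (auto simp: l2_eq_def sq_integrable_scaleC elim: eventually_mono)

lemma scaleC_of_real: "of_real r *\<^sub>C f = r *\<^sub>R f"
  by transfer (auto simp: l2_eq_def sq_integrable_scaleC scaleR_conv_of_real)

(* The semigroup is the family for t >= 0; negative t play no role. *)
lift_definition right_shift :: "real \<Rightarrow> l2 \<Rightarrow> l2" is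
  "\<lambda>t f x. if t \<le> x then f (x - t) else 0"
  by (simp add: l2_eq_def sq_integrable_shift AE_shift del: if_cong)

definition gen_dom :: "(real \<Rightarrow> 'a::real_normed_vector \<Rightarrow> 'a) \<Rightarrow> 'a set"
  where "gen_dom S = {x. \<exists>y. ((\<lambda>h. (S h x - x) /\<^sub>R h) \<longlongrightarrow> y) (at_right 0)}"

definition generator :: "(real \<Rightarrow> 'a::real_normed_vector \<Rightarrow> 'a) \<Rightarrow> 'a \<Rightarrow> 'a"
  where "generator S x = Lim (at_right 0) (\<lambda>h. (S h x - x) /\<^sub>R h)"

(* R(z, A) = (z I - A)^{-1} for an operator A with domain D; meaningful for z in the resolvent
   set. The right shift semigroup is contractive, so its generator has every z with Re z > 0
   there; C R(z, A) is then bounded for graph-bounded C, and onorm is its dual norm. *)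
definition resolvent :: "l2 set \<Rightarrow> (l2 \<Rightarrow> l2) \<Rightarrow> complex \<Rightarrow> l2 \<Rightarrow> l2"
  where "resolvent D A z = inv_into D (\<lambda>x. z *\<^sub>C x - A x)"

(* Membership in L(D(A), C), where D carries the graph norm of A. Functionals are total
   functions whose values off D are immaterial. *)
definition graph_bounded_functional :: "l2 set \<Rightarrow> (l2 \<Rightarrow> l2) \<Rightarrow> (l2 \<Rightarrow> complex) \<Rightarrow> bool"
  where "graph_bounded_functional D A C \<longleftrightarrow>
    (\<forall>x\<in>D. \<forall>y\<in>D. C (x + y) = C x + C y) \<and>
    (\<forall>c. \<forall>x\<in>D. C (c *\<^sub>C x) = c * C x) \<and>
    (\<exists>K. \<forall>x\<in>D. cmod (C x) \<le> K * (norm x + norm (A x)))"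

(* The integral is taken in [0, \<infinity>], so its divergence violates the bound. *)
definition admissible :: "real \<Rightarrow> (real \<Rightarrow> l2 \<Rightarrow> l2) \<Rightarrow> (l2 \<Rightarrow> complex) \<Rightarrow> bool"
  where "admissible \<alpha> S C \<longleftrightarrow>
    (\<exists>M>0. \<forall>x\<in>gen_dom S.
      (\<integral>\<^sup>+t\<in>{0..}. ennreal (t powr \<alpha> * (cmod (C (S t x)))\<^sup>2) \<partial>lborel)
        \<le> ennreal (M\<^sup>2 * (norm x)\<^sup>2))"

end

theory Submission
  imports Defs
begin

text \<open>
  Elements of the domain of \<open>A\<close> have continuous representatives, and the witness is the weighted
  sum of point evaluations \<open>C x = (\<Sum>k. 2 powr (- k * \<alpha> / 2) * x (2 ^ k))\<close>. With \<open>\<sigma> = Re z\<close>,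
  Cauchy-Schwarz bounds \<open>y \<mapsto> (R(z, A) y) (p)\<close> by the minimum of \<open>sqrt p\<close> and \<open>1 / sqrt \<sigma>\<close>; summing
  over \<open>p = 2 ^ k\<close>, the terms on either side of \<open>2 ^ k = 1 / \<sigma>\<close> decay geometrically, so the total is
  of order \<open>\<sigma> powr (- (1 - \<alpha>) / 2)\<close>. On the other hand, for a suitable nonnegative \<open>x\<close> in the domain, the
  value \<open>x (2 ^ k - t)\<close> stays away from zero when \<open>1 / 2 \<le> 2 ^ k - t \<le> 1\<close>. There the factor \<open>t powr \<alpha>\<close>
  cancels the square of the \<open>k\<close>-th weight up to a constant, so each of these infinitely many
  disjoint intervals contributes at least a fixed amount to the integral.

  The evaluation at \<open>p\<close> is expressed as \<open>x (p) = \<integral>\<^sub>0\<^sup>p exp (- (p - s)) (x - A x) (s) ds\<close>, a bounded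
  functional of \<open>x - A x\<close>.
\<close>

subsection \<open>Representatives on the real line\<close>

lemma integrable_mult_sq:
  fixes f g :: "'a \<Rightarrow> complex"
  assumes [measurable]: "f \<in> borel_measurable M" "g \<in> borel_measurable M"
    and "integrable M (\<lambda>x. (cmod (f x))\<^sup>2)" "integrable M (\<lambda>x. (cmod (g x))\<^sup>2)"
  shows "integrable M (\<lambda>x. f x * g x)"
proof (rule Bochner_Integration.integrable_bound
    [where f = "\<lambda>x. (cmod (f x))\<^sup>2 + (cmod (g x))\<^sup>2"])
  have "cmod (f x) * cmod (g x) \<le> (cmod (f x))\<^sup>2 + (cmod (g x))\<^sup>2" for x
    using sum_squares_bound[of "cmod (f x)" "cmod (g x)"]
      mult_nonneg_nonneg[OF norm_ge_zero norm_ge_zero, of "f x" "g x"] by linarith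
  then show "AE x in M. norm (f x * g x) \<le> norm ((cmod (f x))\<^sup>2 + (cmod (g x))\<^sup>2)"
    by (simp add: norm_mult)
qed (use assms in auto)

lemma cmod_integral_mult_le:
  fixes f g :: "'a \<Rightarrow> complex"
  assumes [measurable]: "f \<in> borel_measurable M" "g \<in> borel_measurable M"
    and "integrable M (\<lambda>x. (cmod (f x))\<^sup>2)" "integrable M (\<lambda>x. (cmod (g x))\<^sup>2)"
  shows "(cmod (\<integral>x. f x * g x \<partial>M))\<^sup>2 \<le> (\<integral>x. (cmod (f x))\<^sup>2 \<partial>M) * (\<integral>x. (cmod (g x))\<^sup>2 \<partial>M)"
proof -
  have int: "integrable M (\<lambda>x. f x * g x)"
    using assms by (rule integrable_mult_sq)
  have "ennreal ((cmod (\<integral>x. f x * g x \<partial>M))\<^sup>2) \<le> ennreal ((\<integral>x. cmod (f x) * cmod (g x) \<partial>M)\<^sup>2)"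
    using integral_norm_bound[of M "\<lambda>x. f x * g x"]
    by (intro ennreal_leI power_mono) (simp_all add: norm_mult)
  also have "\<dots> = (\<integral>\<^sup>+x. ennreal (cmod (f x)) * ennreal (cmod (g x)) \<partial>M)\<^sup>2"
    using integrable_norm[OF int]
    by (simp add: ennreal_mult[symmetric] nn_integral_eq_integral norm_mult ennreal_power integral_nonneg)
  also have "\<dots> \<le> (\<integral>\<^sup>+x. ennreal (cmod (f x)) ^ 2 \<partial>M) * (\<integral>\<^sup>+x. ennreal (cmod (g x)) ^ 2 \<partial>M)"
    by (rule Cauchy_Schwarz_nn_integral) auto
  also have "\<dots> = ennreal ((\<integral>x. (cmod (f x))\<^sup>2 \<partial>M) * (\<integral>x. (cmod (g x))\<^sup>2 \<partial>M))"
    using assms(3,4) by (simp add: ennreal_power nn_integral_eq_integral ennreal_mult)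
  finally show ?thesis
    by (subst (asm) ennreal_le_iff) (auto intro!: mult_nonneg_nonneg)
qed

text \<open>Representatives extended by zero to the real line, on which the right shift is a translation.\<close>

definition half_line_sq :: "(real \<Rightarrow> complex) \<Rightarrow> bool"
  where "half_line_sq f \<longleftrightarrow> f \<in> borel_measurable borel \<and>
    integrable lborel (\<lambda>s. (cmod (f s))\<^sup>2) \<and> (\<forall>s<0. f s = 0)"

lemma half_line_sq_indicator:
  assumes "half_line_sq f"
  shows "indicator {0..} s *\<^sub>R f s = f s"
  using assms by (auto simp: half_line_sq_def indicator_def)

lemma half_line_sqD:
  assumes "half_line_sq f"
  shows "f \<in> borel_measurable borel" "integrable lborel (\<lambda>s. (cmod (f s))\<^sup>2)"
    "s < 0 \<Longrightarrow> f s = 0"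
  using assms by (auto simp: half_line_sq_def)

lemma sq_integrable_half_line_sq:
  assumes "half_line_sq f"
  shows "sq_integrable f"
  using assms by (simp add: sq_integrable_iff_lborel half_line_sq_indicator) (simp add: half_line_sq_def)

lemma l2_eq_refl:
  assumes "half_line_sq f"
  shows "l2_eq f f"
  using sq_integrable_half_line_sq[OF assms] by (simp add: l2_eq_def)

lemma l2_cases:
  obtains f where "half_line_sq f" "x = abs_l2 f"
proof -
  have "l2_eq (rep_l2 x) (rep_l2 x)" and x: "x = abs_l2 (rep_l2 x)"
    using Quotient3_rep_reflp[OF Quotient3_l2] Quotient3_abs_rep[OF Quotient3_l2] by auto
  then have r: "sq_integrable (rep_l2 x)"
    by (simp add: l2_eq_def)
  let ?f = "\<lambda>s. indicator {0..} s *\<^sub>R rep_l2 x s"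
  have f: "half_line_sq ?f"
    using r by (auto simp: sq_integrable_iff_lborel half_line_sq_def)
  have "l2_eq (rep_l2 x) ?f"
    using r sq_integrable_half_line_sq[OF f] by (auto simp: l2_eq_def AE_half_line_iff)
  then have "abs_l2 (rep_l2 x) = abs_l2 ?f"
    by (rule Quotient3_rel_abs[OF Quotient3_l2])
  with f x that show ?thesis
    by metis
qed

lemma integral_half_line:
  fixes f :: "real \<Rightarrow> 'a::{banach, second_countable_topology}"
  assumes "\<And>s. s < 0 \<Longrightarrow> f s = 0"
  shows "integral\<^sup>L half_line f = integral\<^sup>L lborel f"
proof -
  have "integral\<^sup>L half_line f = (\<integral>s. indicator {0..} s *\<^sub>R f s \<partial>lborel)"
    unfolding half_line_def by (subst integral_restrict_space) auto
  also have "\<dots> = integral\<^sup>L lborel f"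
    using assms by (intro Bochner_Integration.integral_cong) (auto simp: indicator_def)
  finally show ?thesis .
qed

lemma norm_abs_l2:
  assumes "half_line_sq f"
  shows "(norm (abs_l2 f))\<^sup>2 = (\<integral>s. (cmod (f s))\<^sup>2 \<partial>lborel)"
  using assms by (simp add: norm_l2.abs_eq l2_eq_refl integral_half_line half_line_sqD)

lemma half_line_sq_add: "half_line_sq f \<Longrightarrow> half_line_sq g \<Longrightarrow> half_line_sq (\<lambda>s. f s + g s)"
  and half_line_sq_diff: "half_line_sq f \<Longrightarrow> half_line_sq g \<Longrightarrow> half_line_sq (\<lambda>s. f s - g s)"
  and half_line_sq_scale: "half_line_sq f \<Longrightarrow> half_line_sq (\<lambda>s. c * f s)"
proof -
  have *: "half_line_sq f" if "sq_integrable f" "f \<in> borel_measurable borel" "\<And>s. s < 0 \<Longrightarrow> f s = 0" for f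
  proof -
    have "(\<lambda>s. indicator {0..} s *\<^sub>R f s) = f"
      using that(3) by (auto simp: indicator_def fun_eq_iff)
    note eq = fun_cong[OF this]
    show ?thesis
      using that unfolding half_line_sq_def sq_integrable_iff_lborel eq by simp
  qed
  show "half_line_sq f \<Longrightarrow> half_line_sq g \<Longrightarrow> half_line_sq (\<lambda>s. f s + g s)"
    by (rule *) (auto intro!: sq_integrable_add borel_measurable_add
        dest: sq_integrable_half_line_sq simp: half_line_sqD)
  show "half_line_sq f \<Longrightarrow> half_line_sq g \<Longrightarrow> half_line_sq (\<lambda>s. f s - g s)"
    by (rule *) (auto intro!: sq_integrable_diff borel_measurable_diff
        dest: sq_integrable_half_line_sq simp: half_line_sqD)
  show "half_line_sq f \<Longrightarrow> half_line_sq (\<lambda>s. c * f s)"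
    by (rule *) (auto intro!: sq_integrable_scaleC borel_measurable_times
        dest: sq_integrable_half_line_sq simp: half_line_sqD)
qed

lemma abs_l2_add: "half_line_sq f \<Longrightarrow> half_line_sq g \<Longrightarrow> abs_l2 f + abs_l2 g = abs_l2 (\<lambda>s. f s + g s)"
  by (simp add: plus_l2.abs_eq l2_eq_refl)

lemma abs_l2_diff: "half_line_sq f \<Longrightarrow> half_line_sq g \<Longrightarrow> abs_l2 f - abs_l2 g = abs_l2 (\<lambda>s. f s - g s)"
  by (simp add: minus_l2.abs_eq l2_eq_refl)

lemma abs_l2_scaleC: "half_line_sq f \<Longrightarrow> c *\<^sub>C abs_l2 f = abs_l2 (\<lambda>s. c * f s)"
  by (simp add: scaleC.abs_eq l2_eq_refl)

lemma half_line_sq_shift: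
  assumes "half_line_sq f" "0 \<le> t"
  shows "half_line_sq (\<lambda>s. f (s - t))"
proof -
  have [measurable]: "f \<in> borel_measurable borel"
    using assms by (simp add: half_line_sqD)
  have "integrable lborel (\<lambda>s. (cmod (f (s - t)))\<^sup>2)"
    using lborel_integrable_real_affine[OF half_line_sqD(2)[OF assms(1)], of 1 "- t"] by simp
  then show ?thesis
    using assms by (auto simp: half_line_sq_def)
qed

lemma right_shift_abs_l2:
  assumes "half_line_sq f" "0 \<le> t"
  shows "right_shift t (abs_l2 f) = abs_l2 (\<lambda>s. f (s - t))"
proof -
  have "(\<lambda>s. if t \<le> s then f (s - t) else 0) = (\<lambda>s. f (s - t))"
    using assms by (auto simp: half_line_sqD)
  then show ?thesis
    using assms by (simp add: right_shift.abs_eq l2_eq_refl)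
qed

lemma norm_right_shift:
  assumes "0 \<le> t"
  shows "norm (right_shift t x) = norm x"
proof -
  obtain f where f: "half_line_sq f" "x = abs_l2 f"
    by (rule l2_cases)
  have "(norm (right_shift t x))\<^sup>2 = (\<integral>s. (cmod (f (s - t)))\<^sup>2 \<partial>lborel)"
    using f assms by (simp add: right_shift_abs_l2 norm_abs_l2 half_line_sq_shift)
  also have "\<dots> = (norm x)\<^sup>2"
    using lborel_integral_real_affine[of 1 "\<lambda>s. (cmod (f s))\<^sup>2" "- t"] f
    by (simp add: norm_abs_l2)
  finally show ?thesis
    by simp
qed

lemma right_shift_add: "0 \<le> t \<Longrightarrow> right_shift t (x + y) = right_shift t x + right_shift t y"
  and right_shift_diff: "0 \<le> t \<Longrightarrow> right_shift t (x - y) = right_shift t x - right_shift t y"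
  and right_shift_scaleC: "0 \<le> t \<Longrightarrow> right_shift t (c *\<^sub>C x) = c *\<^sub>C right_shift t x"
  and right_shift_commute: "0 \<le> t \<Longrightarrow> 0 \<le> h \<Longrightarrow>
    right_shift t (right_shift h x) = right_shift h (right_shift t x)"
proof -
  obtain f g where "half_line_sq f" "x = abs_l2 f" "half_line_sq g" "y = abs_l2 g"
    by (metis l2_cases)
  then show "0 \<le> t \<Longrightarrow> right_shift t (x + y) = right_shift t x + right_shift t y"
    "0 \<le> t \<Longrightarrow> right_shift t (x - y) = right_shift t x - right_shift t y"
    "0 \<le> t \<Longrightarrow> right_shift t (c *\<^sub>C x) = c *\<^sub>C right_shift t x"
    "0 \<le> t \<Longrightarrow> 0 \<le> h \<Longrightarrow> right_shift t (right_shift h x) = right_shift h (right_shift t x)"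
    by (simp_all add: right_shift_abs_l2 abs_l2_add abs_l2_diff abs_l2_scaleC half_line_sq_add
        half_line_sq_diff half_line_sq_scale half_line_sq_shift algebra_simps)
qed

lemma scaleC_add: "c *\<^sub>C (x + y) = c *\<^sub>C x + c *\<^sub>C y"
  and scaleC_diff: "c *\<^sub>C (x - y) = c *\<^sub>C x - c *\<^sub>C y"
  and scaleC_add_left: "(c + d) *\<^sub>C x = c *\<^sub>C x + d *\<^sub>C x"
  and scaleC_scaleC: "c *\<^sub>C (d *\<^sub>C x) = (c * d) *\<^sub>C x"
  and scaleC_one: "1 *\<^sub>C x = x"
  and norm_scaleC: "norm (c *\<^sub>C x) = cmod c * norm x"
proof -
  obtain f g where fg: "half_line_sq f" "x = abs_l2 f" "half_line_sq g" "y = abs_l2 g"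
    by (metis l2_cases)
  then show "c *\<^sub>C (x + y) = c *\<^sub>C x + c *\<^sub>C y" "c *\<^sub>C (x - y) = c *\<^sub>C x - c *\<^sub>C y"
    "(c + d) *\<^sub>C x = c *\<^sub>C x + d *\<^sub>C x" "c *\<^sub>C (d *\<^sub>C x) = (c * d) *\<^sub>C x" "1 *\<^sub>C x = x"
    by (simp_all add: abs_l2_add abs_l2_diff abs_l2_scaleC half_line_sq_add
        half_line_sq_diff half_line_sq_scale algebra_simps)
  have "(norm (c *\<^sub>C x))\<^sup>2 = (cmod c * norm x)\<^sup>2"
    using fg by (simp add: abs_l2_scaleC norm_abs_l2 half_line_sq_scale power_mult_distrib norm_mult)
  then show "norm (c *\<^sub>C x) = cmod c * norm x"
    by (subst (asm) power2_eq_iff_nonneg) auto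
qed

lift_definition pairing :: "l2 \<Rightarrow> l2 \<Rightarrow> complex" is
  "\<lambda>f g. integral\<^sup>L half_line (\<lambda>s. f s * g s)"
  by (rule integral_cong_AE) (auto simp: l2_eq_def sq_integrable_def elim: eventually_elim2)

lemma pairing_abs_l2:
  assumes "half_line_sq f" "half_line_sq g"
  shows "pairing (abs_l2 f) (abs_l2 g) = (\<integral>s. f s * g s \<partial>lborel)"
  using assms by (simp add: pairing.abs_eq l2_eq_refl integral_half_line half_line_sqD)

lemma integrable_mult_half_line_sq:
  assumes "half_line_sq f" "half_line_sq g"
  shows "integrable lborel (\<lambda>s. f s * g s)"
  using assms by (intro integrable_mult_sq) (auto simp: half_line_sqD)

lemma cmod_pairing_le: "cmod (pairing x y) \<le> norm x * norm y"
proof -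
  obtain f g where fg: "half_line_sq f" "x = abs_l2 f" "half_line_sq g" "y = abs_l2 g"
    by (metis l2_cases)
  then have "(cmod (pairing x y))\<^sup>2 \<le> (norm x * norm y)\<^sup>2"
    by (auto simp: pairing_abs_l2 norm_abs_l2 power_mult_distrib half_line_sqD
        intro!: cmod_integral_mult_le)
  then show ?thesis
    by (rule power2_le_imp_le) simp
qed

lemma pairing_add: "pairing w (x + y) = pairing w x + pairing w y"
  and pairing_diff: "pairing w (x - y) = pairing w x - pairing w y"
  and pairing_diff_left: "pairing (x - y) w = pairing x w - pairing y w"
  and pairing_scaleC: "pairing w (c *\<^sub>C x) = c * pairing w x"
  and pairing_scaleC_left: "pairing (c *\<^sub>C x) w = c * pairing x w"
proof -
  obtain f g e where "half_line_sq f" "x = abs_l2 f" "half_line_sq g" "y = abs_l2 g"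
    "half_line_sq e" "w = abs_l2 e"
    by (metis l2_cases)
  then show "pairing w (x + y) = pairing w x + pairing w y"
    "pairing w (x - y) = pairing w x - pairing w y"
    "pairing (x - y) w = pairing x w - pairing y w"
    "pairing w (c *\<^sub>C x) = c * pairing w x"
    "pairing (c *\<^sub>C x) w = c * pairing x w"
    by (simp_all add: pairing_abs_l2 abs_l2_add abs_l2_diff abs_l2_scaleC half_line_sq_add
        half_line_sq_diff half_line_sq_scale integrable_mult_half_line_sq algebra_simps)
qed


subsection \<open>Convolution and convergence\<close>

lemma sq_norm_convolution_le:
  fixes k Z :: "real \<Rightarrow> complex"
  assumes k: "integrable lborel k" and Z[measurable]: "Z \<in> borel_measurable borel"
  shows "(\<integral>\<^sup>+t. ennreal ((cmod (\<integral>u. k u * Z (t - u) \<partial>lborel))\<^sup>2) \<partial>lborel)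
    \<le> ennreal ((\<integral>u. cmod (k u) \<partial>lborel)\<^sup>2) * (\<integral>\<^sup>+s. ennreal ((cmod (Z s))\<^sup>2) \<partial>lborel)"
proof -
  have [measurable]: "k \<in> borel_measurable borel"
    using k by simp
  define m where "m = (\<integral>\<^sup>+u. ennreal (cmod (k u)) \<partial>lborel)"
  have m: "m = ennreal (\<integral>u. cmod (k u) \<partial>lborel)"
    unfolding m_def using k by (intro nn_integral_eq_integral) auto
  have cs: "ennreal ((cmod (\<integral>u. k u * Z (t - u) \<partial>lborel))\<^sup>2)
      \<le> m * (\<integral>\<^sup>+u. ennreal (cmod (k u) * (cmod (Z (t - u)))\<^sup>2) \<partial>lborel)" for t
  proof -
    have "ennreal (cmod (\<integral>u. k u * Z (t - u) \<partial>lborel)) \<le> (\<integral>\<^sup>+u. ennreal (cmod (k u * Z (t - u))) \<partial>lborel)"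
      by (cases "integrable lborel (\<lambda>u. k u * Z (t - u))")
         (auto simp: not_integrable_integral_eq integral_norm_bound_ennreal)
    then have "(ennreal (cmod (\<integral>u. k u * Z (t - u) \<partial>lborel)))\<^sup>2
        \<le> (\<integral>\<^sup>+u. ennreal (cmod (k u * Z (t - u))) \<partial>lborel)\<^sup>2"
      by (rule power_mono) simp
    also have "\<dots> = (\<integral>\<^sup>+u. ennreal (sqrt (cmod (k u))) * ennreal (sqrt (cmod (k u)) * cmod (Z (t - u))) \<partial>lborel)\<^sup>2"
      by (intro arg_cong[where f = "\<lambda>x. x\<^sup>2"] nn_integral_cong)
         (simp add: ennreal_mult[symmetric] norm_mult mult.assoc[symmetric])
    also have "\<dots> \<le> (\<integral>\<^sup>+u. (ennreal (sqrt (cmod (k u))))\<^sup>2 \<partial>lborel)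
        * (\<integral>\<^sup>+u. (ennreal (sqrt (cmod (k u)) * cmod (Z (t - u))))\<^sup>2 \<partial>lborel)"
      by (rule Cauchy_Schwarz_nn_integral) auto
    also have "\<dots> = m * (\<integral>\<^sup>+u. ennreal (cmod (k u) * (cmod (Z (t - u)))\<^sup>2) \<partial>lborel)"
      by (simp add: m_def ennreal_power power_mult_distrib)
    finally show ?thesis
      by (simp add: ennreal_power)
  qed
  have "(\<integral>\<^sup>+t. ennreal ((cmod (\<integral>u. k u * Z (t - u) \<partial>lborel))\<^sup>2) \<partial>lborel)
      \<le> (\<integral>\<^sup>+t. m * (\<integral>\<^sup>+u. ennreal (cmod (k u) * (cmod (Z (t - u)))\<^sup>2) \<partial>lborel) \<partial>lborel)"
    by (intro nn_integral_mono cs)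
  also have "\<dots> = m * (\<integral>\<^sup>+t. (\<integral>\<^sup>+u. ennreal (cmod (k u) * (cmod (Z (t - u)))\<^sup>2) \<partial>lborel) \<partial>lborel)"
    by (rule nn_integral_cmult) simp
  also have "(\<integral>\<^sup>+t. (\<integral>\<^sup>+u. ennreal (cmod (k u) * (cmod (Z (t - u)))\<^sup>2) \<partial>lborel) \<partial>lborel)
      = (\<integral>\<^sup>+u. (\<integral>\<^sup>+t. ennreal (cmod (k u) * (cmod (Z (t - u)))\<^sup>2) \<partial>lborel) \<partial>lborel)"
    by (rule lborel_pair.Fubini') simp
  also have "\<dots> = (\<integral>\<^sup>+u. ennreal (cmod (k u)) * (\<integral>\<^sup>+s. ennreal ((cmod (Z s))\<^sup>2) \<partial>lborel) \<partial>lborel)"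
  proof (rule nn_integral_cong)
    fix u
    have "(\<integral>\<^sup>+t. ennreal (cmod (k u) * (cmod (Z (t - u)))\<^sup>2) \<partial>lborel)
        = ennreal (cmod (k u)) * (\<integral>\<^sup>+t. ennreal ((cmod (Z (t - u)))\<^sup>2) \<partial>lborel)"
      by (subst nn_integral_cmult[symmetric]) (simp_all add: ennreal_mult)
    also have "(\<integral>\<^sup>+t. ennreal ((cmod (Z (t - u)))\<^sup>2) \<partial>lborel) = (\<integral>\<^sup>+s. ennreal ((cmod (Z s))\<^sup>2) \<partial>lborel)"
      using nn_integral_real_affine[of "\<lambda>s. ennreal ((cmod (Z s))\<^sup>2)" 1 "- u"] by simp
    finally show "(\<integral>\<^sup>+t. ennreal (cmod (k u) * (cmod (Z (t - u)))\<^sup>2) \<partial>lborel)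
        = ennreal (cmod (k u)) * (\<integral>\<^sup>+s. ennreal ((cmod (Z s))\<^sup>2) \<partial>lborel)" .
  qed
  also have "\<dots> = m * (\<integral>\<^sup>+s. ennreal ((cmod (Z s))\<^sup>2) \<partial>lborel)"
    unfolding m_def by (rule nn_integral_multc) simp
  also have "m * (m * (\<integral>\<^sup>+s. ennreal ((cmod (Z s))\<^sup>2) \<partial>lborel))
      = ennreal ((\<integral>u. cmod (k u) \<partial>lborel)\<^sup>2) * (\<integral>\<^sup>+s. ennreal ((cmod (Z s))\<^sup>2) \<partial>lborel)"
    by (simp only: m power2_eq_square[of "integral\<^sup>L _ _"] mult.assoc ennreal_mult
        Bochner_Integration.integral_nonneg norm_ge_zero)
  finally show ?thesis .
qed

lemma half_line_sq_convolution:
  assumes k: "integrable lborel k" "\<And>u. u < 0 \<Longrightarrow> k u = 0" and Z: "half_line_sq Z"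
  shows "half_line_sq (\<lambda>t. \<integral>u. k u * Z (t - u) \<partial>lborel)" (is "half_line_sq ?w")
    and "norm (abs_l2 (\<lambda>t. \<integral>u. k u * Z (t - u) \<partial>lborel))
      \<le> (\<integral>u. cmod (k u) \<partial>lborel) * norm (abs_l2 Z)"
proof -
  have [measurable]: "k \<in> borel_measurable borel" "Z \<in> borel_measurable borel"
    using k Z by (auto simp: half_line_sqD)
  have meas: "?w \<in> borel_measurable borel"
    by measurable
  have "(\<integral>\<^sup>+t. ennreal ((cmod (?w t))\<^sup>2) \<partial>lborel)
      \<le> ennreal ((\<integral>u. cmod (k u) \<partial>lborel)\<^sup>2) * (\<integral>\<^sup>+s. ennreal ((cmod (Z s))\<^sup>2) \<partial>lborel)"
    by (rule sq_norm_convolution_le) (use k in auto)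
  also have "\<dots> = ennreal ((\<integral>u. cmod (k u) \<partial>lborel)\<^sup>2) * ennreal ((norm (abs_l2 Z))\<^sup>2)"
    using Z by (simp add: nn_integral_eq_integral half_line_sqD norm_abs_l2)
  also have "\<dots> = ennreal (((\<integral>u. cmod (k u) \<partial>lborel) * norm (abs_l2 Z))\<^sup>2)"
    by (simp add: ennreal_mult[symmetric] power_mult_distrib)
  finally have le: "(\<integral>\<^sup>+t. ennreal ((cmod (?w t))\<^sup>2) \<partial>lborel)
      \<le> ennreal (((\<integral>u. cmod (k u) \<partial>lborel) * norm (abs_l2 Z))\<^sup>2)" .
  have int: "integrable lborel (\<lambda>t. (cmod (?w t))\<^sup>2)"
    using le meas by (intro integrableI_bounded) (auto intro: le_less_trans)
  have zero: "k u * Z (t - u) = 0" if "t < 0" for t u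
    using k(2)[of u] half_line_sqD(3)[OF Z, of "t - u"] that by (cases "u < 0") auto
  have "?w t = 0" if "t < 0" for t
    by (simp only: zero[OF that] integral_zero)
  then show w: "half_line_sq ?w"
    unfolding half_line_sq_def using int meas by simp
  have "ennreal ((norm (abs_l2 ?w))\<^sup>2) \<le> ennreal (((\<integral>u. cmod (k u) \<partial>lborel) * norm (abs_l2 Z))\<^sup>2)"
    using le int by (simp add: norm_abs_l2[OF w] nn_integral_eq_integral)
  then show "norm (abs_l2 ?w) \<le> (\<integral>u. cmod (k u) \<partial>lborel) * norm (abs_l2 Z)"
    by (subst (asm) ennreal_le_iff) (simp, rule power2_le_imp_le, simp_all)
qed

lemma norm_sq_abs_l2_liminf:
  assumes F: "\<And>n. half_line_sq (F n)" and G: "half_line_sq G"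
    and lim: "AE s in lborel. (\<lambda>n. F n s) \<longlonglongrightarrow> G s" and "a < (norm (abs_l2 G))\<^sup>2"
  shows "\<forall>\<^sub>F n :: nat in sequentially. a < (norm (abs_l2 (F n)))\<^sup>2"
proof -
  have [measurable]: "F n \<in> borel_measurable borel" "G \<in> borel_measurable borel" for n
    using F G by (auto simp: half_line_sqD)
  have nn: "(\<integral>\<^sup>+s. ennreal ((cmod (H s))\<^sup>2) \<partial>lborel) = ennreal ((norm (abs_l2 H))\<^sup>2)"
    if "half_line_sq H" for H
    using that by (simp add: nn_integral_eq_integral half_line_sqD norm_abs_l2)
  have "(\<integral>\<^sup>+s. ennreal ((cmod (G s))\<^sup>2) \<partial>lborel) = (\<integral>\<^sup>+s. liminf (\<lambda>n. ennreal ((cmod (F n s))\<^sup>2)) \<partial>lborel)"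
    using lim
    by (intro nn_integral_cong_AE, elim eventually_mono)
       (auto intro!: lim_imp_Liminf[symmetric] tendsto_intros)
  also have "\<dots> \<le> liminf (\<lambda>n. \<integral>\<^sup>+s. ennreal ((cmod (F n s))\<^sup>2) \<partial>lborel)"
    by (rule nn_integral_liminf) auto
  finally have le: "ennreal ((norm (abs_l2 G))\<^sup>2) \<le> liminf (\<lambda>n. ennreal ((norm (abs_l2 (F n)))\<^sup>2))"
    by (simp add: nn F G)
  show ?thesis
  proof (cases "0 \<le> a")
    case True
    then have "ennreal a < ennreal ((norm (abs_l2 G))\<^sup>2)"
      using assms(4) by (simp add: ennreal_less_iff)
    with le have "\<forall>\<^sub>F n in sequentially. ennreal a < ennreal ((norm (abs_l2 (F n)))\<^sup>2)"
      by (intro less_LiminfD) auto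
    then show ?thesis
      using True by (simp add: ennreal_less_iff)
  next
    case False
    then show ?thesis
      using less_le_trans[of a 0, OF _ zero_le_power2] by (simp add: not_le)
  qed
qed

text \<open>By the parallelogram law, a lower bound for the norm of the sum of \<open>F n\<close> and \<open>G\<close>
  suffices, and that follows from Fatou's lemma.\<close>

lemma abs_l2_tendstoI:
  assumes F: "\<And>n. half_line_sq (F n)" and G: "half_line_sq G"
    and lim: "AE s in lborel. (\<lambda>n. F n s) \<longlonglongrightarrow> G s"
    and le: "\<And>n. norm (abs_l2 (F n)) \<le> norm (abs_l2 G)"
  shows "(\<lambda>n. abs_l2 (F n)) \<longlonglongrightarrow> abs_l2 G"
proof (rule tendstoI)
  fix e :: real assume e: "0 < e"
  let ?G = "abs_l2 G"
  have GG: "norm (abs_l2 (\<lambda>s. G s + G s)) = 2 * norm ?G"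
    unfolding abs_l2_add[OF G G, symmetric] by (simp flip: scaleR_2)
  have "\<forall>\<^sub>F n in sequentially. (norm (abs_l2 (\<lambda>s. G s + G s)))\<^sup>2 - e\<^sup>2 < (norm (abs_l2 (\<lambda>s. F n s + G s)))\<^sup>2"
  proof (rule norm_sq_abs_l2_liminf)
    show "AE s in lborel. (\<lambda>n. F n s + G s) \<longlonglongrightarrow> G s + G s"
      using lim by (elim eventually_mono) (intro tendsto_add tendsto_const)
  qed (use half_line_sq_add[OF F G] half_line_sq_add[OF G G] e in simp_all)
  then show "\<forall>\<^sub>F n in sequentially. dist (abs_l2 (F n)) ?G < e"
  proof eventually_elim
    case (elim n)
    let ?F = "abs_l2 (F n)"
    have "4 * (norm ?G)\<^sup>2 - e\<^sup>2 < (norm (?F + ?G))\<^sup>2"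
      using elim F G by (simp only: GG abs_l2_add) (simp add: power_mult_distrib)
    moreover have "(norm (?F - ?G))\<^sup>2 = 2 * (norm ?F)\<^sup>2 + 2 * (norm ?G)\<^sup>2 - (norm (?F + ?G))\<^sup>2"
      by (simp add: power2_norm_eq_inner inner_simps inner_commute)
    moreover have "(norm ?F)\<^sup>2 \<le> (norm ?G)\<^sup>2"
      using le by (intro power_mono) auto
    ultimately have "(norm (?F - ?G))\<^sup>2 < e\<^sup>2"
      by linarith
    then show ?case
      unfolding dist_norm by (rule power2_less_imp_less) (use e in simp)
  qed
qed


subsection \<open>One-sided averages\<close>

lemma AE_uminus:
  fixes P :: "real \<Rightarrow> bool"
  assumes "AE s in lborel. P s"
  shows "AE s in lborel. P (- s)"
proof -
  from assms obtain N where N: "N \<in> null_sets lborel" "{s. \<not> P s} \<subseteq> N"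
    by (auto simp: eventually_ae_filter)
  then have "AE s in lborel. s \<notin> N"
    by (intro AE_not_in)
  moreover have [measurable]: "N \<in> sets borel"
    using N by (auto simp: null_sets_def)
  ultimately have "AE s in lborel. 0 + (-1) * s \<notin> N"
    by (intro AE_borel_affine[where t = 0 and c = "-1"]) auto
  then show ?thesis
    using N(2) by (elim eventually_mono) auto
qed

lemma AE_right_average_tendsto:
  fixes f :: "real \<Rightarrow> complex"
  assumes "\<And>a b. f integrable_on {a..b}"
  shows "AE s in lborel. ((\<lambda>h. integral {s..s + h} f /\<^sub>R h) \<longlongrightarrow> f s) (at_right 0)"
proof -
  have "\<And>a b. f integrable_on cbox a b"
    using assms by simp
  from integrable_ccontinuous_explicit[OF this] obtain N where N: "negligible N"
    and lim: "\<And>x e. \<lbrakk>x \<notin> N; 0 < e\<rbrakk> \<Longrightarrow> \<exists>d>0. \<forall>h. 0 < h \<and> h < d \<longrightarrow>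
                         norm (integral (cbox x (x + h *\<^sub>R One)) f /\<^sub>R h ^ DIM(real) - f x) < e"
    by metis
  have "AE s in completion lborel. s \<notin> N"
    using N by (intro AE_not_in) (simp add: negligible_iff_null_sets)
  then have "AE s in lborel. s \<notin> N"
    by (simp add: AE_completion_iff)
  then show ?thesis
  proof eventually_elim
    case (elim s)
    show ?case
    proof (rule tendstoI)
      fix e :: real assume "0 < e"
      from lim[OF elim this] obtain d where d: "d > 0"
        "\<forall>h. 0 < h \<and> h < d \<longrightarrow> norm (integral {s..s + h} f /\<^sub>R h - f s) < e"
        by auto
      then show "\<forall>\<^sub>F h in at_right 0. dist (integral {s..s + h} f /\<^sub>R h) (f s) < e"
        unfolding eventually_at_right_field dist_norm by auto
    qed
  qed
qed

lemma sq_integrable_on_interval: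
  fixes g :: "real \<Rightarrow> complex"
  assumes "continuous_on UNIV g"
  shows "integrable lborel (\<lambda>s. (cmod (indicator {a..b} s *\<^sub>R g s))\<^sup>2)"
proof -
  have "integrable lborel (\<lambda>s. indicator {a..b} s *\<^sub>R (cmod (g s))\<^sup>2)"
    by (rule borel_integrable_compact)
       (auto intro!: continuous_intros continuous_on_subset[OF assms])
  also have "(\<lambda>s. indicator {a..b} s *\<^sub>R (cmod (g s))\<^sup>2)
      = (\<lambda>s. (cmod (indicator {a..b} s *\<^sub>R g s))\<^sup>2)"
    by (auto simp: indicator_def)
  finally show ?thesis .
qed

lemma set_integrable_continuous_mult:
  fixes g f :: "real \<Rightarrow> complex"
  assumes g: "continuous_on UNIV g"
    and f: "f \<in> borel_measurable borel" "integrable lborel (\<lambda>s. (cmod (f s))\<^sup>2)"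
  shows "set_integrable lborel {a..b} (\<lambda>s. g s * f s)"
proof -
  have [measurable]: "g \<in> borel_measurable borel"
    using g by (rule borel_measurable_continuous_onI)
  have "integrable lborel (\<lambda>s. (indicator {a..b} s *\<^sub>R g s) * f s)"
    using f sq_integrable_on_interval[OF g] by (intro integrable_mult_sq) auto
  then show ?thesis
    by (simp add: set_integrable_def)
qed

lemma integral_indicator_atLeastLessThan:
  fixes f :: "real \<Rightarrow> complex"
  shows "(\<integral>u. indicator {a..<b} u *\<^sub>R f u \<partial>lborel) = (\<integral>u. indicator {a..b} u *\<^sub>R f u \<partial>lborel)"
  by (rule integral_discrete_difference[where X = "{b}"]) (auto simp: indicator_def)

lemma AE_left_average_tendsto:
  fixes Z :: "real \<Rightarrow> complex"
  assumes Z: "half_line_sq Z"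
  shows "AE t in lborel. ((\<lambda>h. (\<integral>u. indicator {0..h} u *\<^sub>R exp (- z * of_real u) * Z (t - u) \<partial>lborel) /\<^sub>R h)
    \<longlongrightarrow> Z t) (at_right 0)"
proof -
  have [measurable]: "Z \<in> borel_measurable borel"
    using Z by (simp add: half_line_sqD)
  define g where "g = (\<lambda>s. exp (- z * of_real s) * Z (- s))"
  have sq: "integrable lborel (\<lambda>s. (cmod (Z (- s)))\<^sup>2)"
    using lborel_integrable_real_affine[OF half_line_sqD(2)[OF Z], of "-1" 0] by simp
  have g: "set_integrable lborel {a..b} g" for a b
    unfolding g_def using sq
    by (intro set_integrable_continuous_mult) (auto intro!: continuous_intros)
  have "AE s in lborel. ((\<lambda>h. integral {s..s + h} g /\<^sub>R h) \<longlongrightarrow> g s) (at_right 0)"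
    by (rule AE_right_average_tendsto) (rule set_borel_integral_eq_integral[OF g])
  then have "AE t in lborel. ((\<lambda>h. integral {- t..- t + h} g /\<^sub>R h) \<longlongrightarrow> g (- t)) (at_right 0)"
    by (rule AE_uminus)
  then show ?thesis
  proof eventually_elim
    case (elim t)
    have eq: "integral {- t..- t + h} g
        = exp (z * of_real t) * (\<integral>u. indicator {0..h} u *\<^sub>R exp (- z * of_real u) * Z (t - u) \<partial>lborel)" for h
    proof -
      have "integral {- t..- t + h} g = (\<integral>s. indicator {- t..- t + h} s *\<^sub>R g s \<partial>lborel)"
        using set_borel_integral_eq_integral(2)[OF g] by (simp add: set_lebesgue_integral_def)
      also have "\<dots> = (\<integral>u. indicator {- t..- t + h} (- t + u) *\<^sub>R g (- t + u) \<partial>lborel)"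
        using lborel_integral_real_affine[of 1 "\<lambda>s. indicator {- t..- t + h} s *\<^sub>R g s" "- t"] by simp
      also have "\<dots> = (\<integral>u. exp (z * of_real t) * (indicator {0..h} u *\<^sub>R exp (- z * of_real u) * Z (t - u)) \<partial>lborel)"
        by (intro Bochner_Integration.integral_cong)
           (auto simp: g_def indicator_def exp_add[symmetric] algebra_simps)
      also have "\<dots> = exp (z * of_real t) * (\<integral>u. indicator {0..h} u *\<^sub>R exp (- z * of_real u) * Z (t - u) \<partial>lborel)"
        by (rule integral_mult_right_zero)
      finally show ?thesis .
    qed
    have "((\<lambda>h. exp (- z * of_real t) * (integral {- t..- t + h} g /\<^sub>R h)) \<longlongrightarrow> exp (- z * of_real t) * g (- t)) (at_right 0)"
      by (intro tendsto_intros elim)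
    moreover have "exp (- z * of_real t) * (integral {- t..- t + h} g /\<^sub>R h)
        = (\<integral>u. indicator {0..h} u *\<^sub>R exp (- z * of_real u) * Z (t - u) \<partial>lborel) /\<^sub>R h" for h
      unfolding eq mult_scaleR_right mult.assoc[symmetric] exp_add[symmetric] by simp
    moreover have "exp (- z * of_real t) * g (- t) = Z t"
      by (simp add: g_def exp_minus)
    ultimately show ?case
      by (simp only:)
  qed
qed


subsection \<open>Solving the resolvent equation\<close>

interpretation scaleC: bounded_bilinear scaleC
proof
  fix a a' :: complex and b b' :: l2 and r :: real
  show "(a + a') *\<^sub>C b = a *\<^sub>C b + a' *\<^sub>C b" "a *\<^sub>C (b + b') = a *\<^sub>C b + a *\<^sub>C b'"
    by (simp_all add: scaleC_add scaleC_add_left)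
  show "(r *\<^sub>R a) *\<^sub>C b = r *\<^sub>R (a *\<^sub>C b)" "a *\<^sub>C r *\<^sub>R b = r *\<^sub>R (a *\<^sub>C b)"
    by (simp_all add: scaleC_of_real[symmetric] scaleC_scaleC scaleR_conv_of_real mult.commute)
  show "\<exists>K. \<forall>a b. norm (a *\<^sub>C b) \<le> norm a * norm b * K"
    by (intro exI[of _ 1]) (simp add: norm_scaleC)
qed

interpretation pairing: bounded_bilinear pairing
proof
  fix a a' b b' :: l2 and r :: real
  show "pairing (a + a') b = pairing a b + pairing a' b"
    using pairing_diff_left[of "a + a'" a' b] by simp
  show "pairing a (b + b') = pairing a b + pairing a b'"
    by (rule pairing_add)
  show "pairing (r *\<^sub>R a) b = r *\<^sub>R pairing a b" "pairing a (r *\<^sub>R b) = r *\<^sub>R pairing a b"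
    by (simp_all add: scaleC_of_real[symmetric] pairing_scaleC pairing_scaleC_left scaleR_conv_of_real)
  show "\<exists>K. \<forall>a b. norm (pairing a b) \<le> norm a * norm b * K"
    by (intro exI[of _ 1]) (simp add: cmod_pairing_le)
qed

lemma exp_difference_quotient_tendsto:
  "((\<lambda>h. (exp (z * of_real h) - 1) /\<^sub>R h) \<longlongrightarrow> (z::complex)) (at_right 0)"
proof -
  have "((\<lambda>h. exp (h *\<^sub>R z)) has_vector_derivative exp (0 *\<^sub>R z) * z) (at 0 within {0<..})"
    by (rule exp_scaleR_has_vector_derivative_right)
  then have "((\<lambda>h. norm (exp (h *\<^sub>R z) - 1 - h *\<^sub>R z) / \<bar>h\<bar>) \<longlongrightarrow> 0) (at_right 0)"
    by (simp add: has_vector_derivative_def has_derivative_iff_norm)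
  moreover have "\<forall>\<^sub>F h :: real in at_right 0. norm (exp (h *\<^sub>R z) - 1 - h *\<^sub>R z) / \<bar>h\<bar>
      = norm ((exp (z * of_real h) - 1) /\<^sub>R h - z)"
    unfolding eventually_at_right_field
  proof (intro exI[of _ 1] conjI allI impI)
    fix h :: real assume "0 < h"
    then have "(exp (z * of_real h) - 1) /\<^sub>R h - z = (exp (h *\<^sub>R z) - 1 - h *\<^sub>R z) /\<^sub>R h"
      by (simp add: scaleR_conv_of_real field_simps)
    with \<open>0 < h\<close> show "norm (exp (h *\<^sub>R z) - 1 - h *\<^sub>R z) / \<bar>h\<bar> = norm ((exp (z * of_real h) - 1) /\<^sub>R h - z)"
      by (simp add: divide_inverse mult.commute)
  qed simp
  ultimately have "((\<lambda>h. norm ((exp (z * of_real h) - 1) /\<^sub>R h - z)) \<longlongrightarrow> 0) (at_right 0)"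
    by (rule Lim_transform_eventually)
  then show ?thesis
    by (simp add: tendsto_norm_zero_iff Lim_null[symmetric])
qed

lemma has_bochner_integral_exp_half_line:
  fixes c :: real
  assumes "0 < c"
  shows "has_bochner_integral lborel (\<lambda>u. indicator {0..} u * exp (- c * u)) (1 / c)"
proof (rule has_bochner_integral_nn_integral)
  have "(\<integral>\<^sup>+u. ennreal (exp (- c * u)) * indicator {0..} u \<partial>lborel) = ennreal (0 - (- exp (- c * 0) / c))"
  proof (rule nn_integral_FTC_atLeast[where F = "\<lambda>u. - exp (- c * u) / c"])
    show "((\<lambda>u. - exp (- c * u) / c) has_real_derivative exp (- c * u)) (at u)" for u
      using assms by (auto intro!: derivative_eq_intros)
    have "filterlim (\<lambda>u. - (c * u)) at_bot at_top"
      unfolding filterlim_uminus_at_bot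
      using assms by (auto intro!: filterlim_tendsto_pos_mult_at_top[OF tendsto_const] filterlim_ident)
    then have "((\<lambda>u. exp (- (c * u))) \<longlongrightarrow> 0) at_top"
      by (rule filterlim_compose[OF exp_at_bot])
    then show "((\<lambda>u. - exp (- c * u) / c) \<longlongrightarrow> 0) at_top"
      using tendsto_divide_zero[of "\<lambda>u. - exp (- c * u)" at_top c] tendsto_minus by fastforce
  qed (use assms in auto)
  then show "(\<integral>\<^sup>+u. ennreal (indicator {0..} u * exp (- c * u)) \<partial>lborel) = ennreal (1 / c)"
    by (simp add: ennreal_mult' ennreal_indicator mult.commute)
qed (use assms in auto)

lemma exp_half_line:
  fixes z :: complex
  assumes "0 < Re z"
  shows half_line_sq_exp: "half_line_sq (\<lambda>u. indicator {0..} u *\<^sub>R exp (- z * of_real u))"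
    and integrable_exp_half_line: "integrable lborel (\<lambda>u. indicator {0..} u *\<^sub>R exp (- z * of_real u))"
proof -
  have meas: "(\<lambda>u. indicator {0..} u *\<^sub>R exp (- z * of_real u)) \<in> borel_measurable borel"
    by measurable
  have "integrable lborel (\<lambda>u. indicator {0..} u * exp (- (2 * Re z) * u))"
    using has_bochner_integral_exp_half_line[of "2 * Re z"] assms by (auto simp: has_bochner_integral_iff)
  also have "(\<lambda>u. indicator {0..} u * exp (- (2 * Re z) * u))
      = (\<lambda>u. (cmod (indicator {0..} u *\<^sub>R exp (- z * of_real u)))\<^sup>2)"
    by (auto simp: fun_eq_iff indicator_def exp_double[symmetric] algebra_simps)
  finally show "half_line_sq (\<lambda>u. indicator {0..} u *\<^sub>R exp (- z * of_real u))"
    using meas by (auto simp: half_line_sq_def)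
  show "integrable lborel (\<lambda>u. indicator {0..} u *\<^sub>R exp (- z * of_real u))"
  proof (rule Bochner_Integration.integrable_bound)
    show "integrable lborel (\<lambda>u. indicator {0..} u * exp (- Re z * u))"
      using has_bochner_integral_exp_half_line[OF assms] by (simp add: has_bochner_integral_iff)
  qed (use meas in \<open>auto simp: indicator_def\<close>)
qed

lemma half_line_sq_indicator_scaleR:
  assumes "half_line_sq f" "A \<in> sets borel"
  shows "half_line_sq (\<lambda>s. indicator A s *\<^sub>R f s)"
proof -
  have [measurable]: "f \<in> borel_measurable borel" "A \<in> sets borel"
    using assms by (auto simp: half_line_sqD)
  have "integrable lborel (\<lambda>s. indicator A s *\<^sub>R (cmod (f s))\<^sup>2)"
    using assms by (intro integrable_mult_indicator) (auto simp: half_line_sqD)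
  also have "(\<lambda>s. indicator A s *\<^sub>R (cmod (f s))\<^sup>2) = (\<lambda>s. (cmod (indicator A s *\<^sub>R f s))\<^sup>2)"
    by (auto simp: indicator_def)
  finally show ?thesis
    using assms by (auto simp: half_line_sq_def)
qed

lemma integrable_mult_reflect:
  assumes "half_line_sq f" "half_line_sq g"
  shows "integrable lborel (\<lambda>u. f u * g (t - u))"
proof (rule integrable_mult_sq)
  show "integrable lborel (\<lambda>u. (cmod (g (t - u)))\<^sup>2)"
    using lborel_integrable_real_affine[OF half_line_sqD(2)[OF assms(2)], of "-1" t] by simp
  have [measurable]: "g \<in> borel_measurable borel"
    using assms by (simp add: half_line_sqD)
  show "(\<lambda>u. g (t - u)) \<in> borel_measurable lborel"
    by measurable
qed (use assms in \<open>auto simp: half_line_sqD\<close>)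

lemma exp_convolution_shift:
  assumes z: "0 < Re z" and Z: "half_line_sq Z" and h: "0 \<le> h"
  defines "X \<equiv> \<lambda>t. \<integral>u. indicator {0..} u *\<^sub>R exp (- z * of_real u) * Z (t - u) \<partial>lborel"
  shows "X (t - h) = exp (z * of_real h) *
    (X t - (\<integral>u. indicator {0..h} u *\<^sub>R exp (- z * of_real u) * Z (t - u) \<partial>lborel))"
proof -
  let ?k = "\<lambda>u. indicator {0..} u *\<^sub>R exp (- z * of_real u)"
  have "half_line_sq (\<lambda>u. indicator {0..<h} u *\<^sub>R ?k u)"
    using half_line_sq_exp[OF z] by (rule half_line_sq_indicator_scaleR) simp
  also have "(\<lambda>u. indicator {0..<h} u *\<^sub>R ?k u) = (\<lambda>u. indicator {0..<h} u *\<^sub>R exp (- z * of_real u))"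
    by (auto simp: indicator_def)
  finally have kh: "half_line_sq (\<lambda>u. indicator {0..<h} u *\<^sub>R exp (- z * of_real u))" .
  have "X (t - h) = (\<integral>v. ?k (v - h) * Z (t - v) \<partial>lborel)"
    using lborel_integral_real_affine[of 1 "\<lambda>u. ?k u * Z (t - h - u)" "- h"]
    by (simp add: X_def)
  also have "\<dots> = (\<integral>v. exp (z * of_real h) * (?k v * Z (t - v) -
      indicator {0..<h} v *\<^sub>R exp (- z * of_real v) * Z (t - v)) \<partial>lborel)"
    using h by (intro Bochner_Integration.integral_cong)
       (auto simp: indicator_def exp_diff exp_minus field_simps)
  also have "\<dots> = exp (z * of_real h) * (X t -
      (\<integral>v. indicator {0..<h} v *\<^sub>R exp (- z * of_real v) * Z (t - v) \<partial>lborel))"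
    unfolding X_def integral_mult_right_zero
    by (subst Bochner_Integration.integral_diff)
       (intro integrable_mult_reflect half_line_sq_exp z Z kh refl)+
  also have "(\<integral>v. indicator {0..<h} v *\<^sub>R exp (- z * of_real v) * Z (t - v) \<partial>lborel)
      = (\<integral>v. indicator {0..h} v *\<^sub>R exp (- z * of_real v) * Z (t - v) \<partial>lborel)"
    using integral_indicator_atLeastLessThan[of 0 h "\<lambda>v. exp (- z * of_real v) * Z (t - v)"]
    by simp
  finally show ?thesis .
qed

lemma average_kernel:
  fixes z :: complex
  assumes z: "0 < Re z" and h: "0 < h"
  defines "k \<equiv> \<lambda>u. (indicator {0..h} u *\<^sub>R exp (- z * of_real u)) /\<^sub>R h"
  shows "integrable lborel k" "(\<integral>u. cmod (k u) \<partial>lborel) \<le> 1"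
proof -
  have "integrable lborel (\<lambda>u. indicator {0..h} u *\<^sub>R exp (- z * of_real u))"
    by (rule borel_integrable_compact) (auto intro!: continuous_intros)
  then show k: "integrable lborel k"
    unfolding k_def by (rule integrable_scaleR_right)
  have "(\<integral>u. cmod (k u) \<partial>lborel) \<le> (\<integral>u. indicator {0..h} u / h \<partial>lborel)"
  proof (rule integral_mono)
    show "integrable lborel (\<lambda>u. cmod (k u))"
      using k by simp
    show "integrable lborel (\<lambda>u. indicator {0..h} u / h)"
      by (intro integrable_divide integrable_real_indicator) (use h in auto)
    show "cmod (k u) \<le> indicator {0..h} u / h" for u
      using z h by (auto simp: k_def indicator_def divide_simps)
  qed
  also have "\<dots> = 1"
    using h by simp
  finally show "(\<integral>u. cmod (k u) \<partial>lborel) \<le> 1" .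
qed

lemma average_tendsto:
  fixes Z :: "real \<Rightarrow> complex"
  assumes z: "0 < Re z" and Z: "half_line_sq Z"
  defines "Y \<equiv> \<lambda>h t. (\<integral>u. indicator {0..h} u *\<^sub>R exp (- z * of_real u) * Z (t - u) \<partial>lborel) /\<^sub>R h"
  shows "0 < h \<Longrightarrow> half_line_sq (Y h)"
    and "((\<lambda>h. abs_l2 (Y h)) \<longlongrightarrow> abs_l2 Z) (at_right 0)"
proof -
  have Y: "Y h = (\<lambda>t. \<integral>u. (indicator {0..h} u *\<^sub>R exp (- z * of_real u)) /\<^sub>R h * Z (t - u) \<partial>lborel)" for h
    by (simp only: Y_def mult_scaleR_left integral_scaleR_right)
  show sq: "half_line_sq (Y h)" if "0 < h" for h
    unfolding Y using that Z by (intro half_line_sq_convolution(1) average_kernel z) auto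
  have le: "norm (abs_l2 (Y h)) \<le> norm (abs_l2 Z)" if h: "0 < h" for h
  proof -
    have "norm (abs_l2 (Y h)) \<le> (\<integral>u. cmod ((indicator {0..h} u *\<^sub>R exp (- z * of_real u)) /\<^sub>R h) \<partial>lborel) * norm (abs_l2 Z)"
      unfolding Y using h Z by (intro half_line_sq_convolution(2) average_kernel z) auto
    also have "\<dots> \<le> 1 * norm (abs_l2 Z)"
      by (intro mult_right_mono average_kernel(2) z h) simp
    finally show ?thesis by simp
  qed
  show "((\<lambda>h. abs_l2 (Y h)) \<longlongrightarrow> abs_l2 Z) (at_right 0)"
  proof (rule tendsto_at_right_sequentially[where b = 1])
    fix S :: "nat \<Rightarrow> real"
    assume S: "\<And>n. 0 < S n" "S \<longlonglongrightarrow> 0"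
    then have "filterlim S (at_right 0) sequentially"
      by (intro tendsto_imp_filterlim_at_right) auto
    then have "AE t in lborel. (\<lambda>n. Y (S n) t) \<longlonglongrightarrow> Z t"
      using AE_left_average_tendsto[OF Z, of z] unfolding Y_def
      by (elim eventually_mono) (rule filterlim_compose)
    then show "(\<lambda>n. abs_l2 (Y (S n))) \<longlonglongrightarrow> abs_l2 Z"
      using S by (intro abs_l2_tendstoI sq le Z) auto
  qed simp
qed

lemma resolvent_equation_solvable:
  assumes z: "0 < Re z"
  obtains x where "((\<lambda>h. (right_shift h x - x) /\<^sub>R h) \<longlongrightarrow> z *\<^sub>C x - y) (at_right 0)"
proof -
  obtain Z where Z: "half_line_sq Z" "y = abs_l2 Z"
    by (rule l2_cases)
  define X where "X = (\<lambda>t. \<integral>u. indicator {0..} u *\<^sub>R exp (- z * of_real u) * Z (t - u) \<partial>lborel)"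
  define Y where "Y = (\<lambda>h t. (\<integral>u. indicator {0..h} u *\<^sub>R exp (- z * of_real u) * Z (t - u) \<partial>lborel) /\<^sub>R h)"
  have X: "half_line_sq X"
    unfolding X_def using Z by (intro half_line_sq_convolution(1) integrable_exp_half_line z) auto
  have Y: "half_line_sq (Y h)" if "0 < h" for h
    unfolding Y_def using z Z(1) that by (rule average_tendsto)
  have "((\<lambda>h. ((exp (z * of_real h) - 1) /\<^sub>R h) *\<^sub>C abs_l2 X - exp (z * of_real h) *\<^sub>C abs_l2 (Y h))
      \<longlongrightarrow> z *\<^sub>C abs_l2 X - exp (z * of_real 0) *\<^sub>C abs_l2 Z) (at_right 0)"
    unfolding Y_def
    by (intro tendsto_diff scaleC.tendsto exp_difference_quotient_tendsto average_tendsto(2)[OF z Z(1)] tendsto_intros)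
  moreover have "\<forall>\<^sub>F h in at_right 0. ((exp (z * of_real h) - 1) /\<^sub>R h) *\<^sub>C abs_l2 X - exp (z * of_real h) *\<^sub>C abs_l2 (Y h)
      = (right_shift h (abs_l2 X) - abs_l2 X) /\<^sub>R h"
    unfolding eventually_at_right_field
  proof (intro exI[of _ 1] conjI allI impI)
    fix h :: real assume h: "0 < h"
    have shift: "(\<lambda>t. X (t - h)) = (\<lambda>t. exp (z * of_real h) * (X t - of_real h * Y h t))"
      unfolding X_def Y_def using h exp_convolution_shift[OF z Z(1), of h]
      by (auto simp: scaleR_conv_of_real)
    have "right_shift h (abs_l2 X) = exp (z * of_real h) *\<^sub>C (abs_l2 X - of_real h *\<^sub>C abs_l2 (Y h))"
      using h X Y by (simp add: right_shift_abs_l2 shift abs_l2_scaleC abs_l2_diff half_line_sq_scale half_line_sq_diff)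
    then show "((exp (z * of_real h) - 1) /\<^sub>R h) *\<^sub>C abs_l2 X - exp (z * of_real h) *\<^sub>C abs_l2 (Y h)
      = (right_shift h (abs_l2 X) - abs_l2 X) /\<^sub>R h"
      using h by (simp add: scaleC_diff scaleC.scaleR_left scaleC.diff_left scaleC_one scaleC_of_real
          scaleC.scaleR_right scaleR_diff_right)
  qed simp
  ultimately have "((\<lambda>h. (right_shift h (abs_l2 X) - abs_l2 X) /\<^sub>R h) \<longlongrightarrow> z *\<^sub>C abs_l2 X - y) (at_right 0)"
    using Z(2) by (simp add: scaleC_one Lim_transform_eventually)
  with that show ?thesis .
qed


subsection \<open>Point evaluations on the domain of the generator\<close>

text \<open>Pairing with \<open>exp_kernel z p 0\<close> maps \<open>y\<close> to the value of \<open>R(z, A) y\<close> at \<open>p\<close>.\<close>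

definition exp_kernel :: "complex \<Rightarrow> real \<Rightarrow> real \<Rightarrow> real \<Rightarrow> complex"
  where "exp_kernel z p a = (\<lambda>s. indicator {a..p} s *\<^sub>R exp (- z * of_real (p - s)))"

lemma half_line_sq_exp_kernel:
  assumes "0 \<le> a"
  shows "half_line_sq (exp_kernel z p a)"
proof -
  have "integrable lborel (\<lambda>s. (cmod (exp_kernel z p a s))\<^sup>2)"
    unfolding exp_kernel_def by (rule sq_integrable_on_interval) (intro continuous_intros)
  then show ?thesis
    using assms by (auto simp: half_line_sq_def exp_kernel_def)
qed

lemma norm_abs_l2_le_interval:
  assumes f: "half_line_sq f" and "a \<le> b" "0 \<le> B"
    and le: "\<And>s. cmod (f s) \<le> B * indicator {a..b} s"
  shows "norm (abs_l2 f) \<le> B * sqrt (b - a)"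
proof (rule power2_le_imp_le)
  have ind: "integrable lborel (\<lambda>s. B\<^sup>2 * indicator {a..b} s :: real)"
    using assms by (intro integrable_mult_right integrable_real_indicator) auto
  have "(norm (abs_l2 f))\<^sup>2 \<le> (\<integral>s. B\<^sup>2 * indicator {a..b} s \<partial>lborel)"
    unfolding norm_abs_l2[OF f]
  proof (rule integral_mono)
    show "(cmod (f s))\<^sup>2 \<le> B\<^sup>2 * indicator {a..b} s" for s
      using power_mono[OF le norm_ge_zero, of s 2] by (auto simp: power_mult_distrib indicator_def)
  qed (use ind f in \<open>auto simp: half_line_sqD\<close>)
  also have "\<dots> = (B * sqrt (b - a))\<^sup>2"
    using assms by (simp add: power_mult_distrib)
  finally show "(norm (abs_l2 f))\<^sup>2 \<le> (B * sqrt (b - a))\<^sup>2" .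
qed (use assms in auto)

lemma cmod_exp_kernel_le:
  assumes "0 \<le> Re z"
  shows "cmod (exp_kernel z p a s) \<le> indicator {a..p} s"
  using assms by (auto simp: exp_kernel_def indicator_def)

lemma norm_exp_kernel_le_sqrt:
  assumes "0 \<le> Re z" "0 \<le> p"
  shows "norm (abs_l2 (exp_kernel z p 0)) \<le> sqrt p"
  using norm_abs_l2_le_interval[of "exp_kernel z p 0" 0 p 1] assms cmod_exp_kernel_le[of z p 0]
  by (simp add: half_line_sq_exp_kernel)

lemma norm_exp_kernel_le_inverse_sqrt:
  assumes z: "0 < Re z"
  shows "norm (abs_l2 (exp_kernel z p 0)) \<le> 1 / sqrt (Re z)"
proof (rule power2_le_imp_le)
  define c where "c = 2 * Re z"
  have c: "0 < c"
    using z by (simp add: c_def)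
  note hb = has_bochner_integral_exp_half_line[OF c]
  have "(norm (abs_l2 (exp_kernel z p 0)))\<^sup>2 = (\<integral>u. (cmod (exp_kernel z p 0 (p - u)))\<^sup>2 \<partial>lborel)"
    using lborel_integral_real_affine[of "-1" "\<lambda>s. (cmod (exp_kernel z p 0 s))\<^sup>2" p]
    by (simp add: norm_abs_l2 half_line_sq_exp_kernel)
  also have "\<dots> \<le> (\<integral>u. indicator {0..} u * exp (- c * u) \<partial>lborel)"
  proof (rule integral_mono)
    show "integrable lborel (\<lambda>u. (cmod (exp_kernel z p 0 (p - u)))\<^sup>2)"
      using lborel_integrable_real_affine[OF half_line_sqD(2)[OF half_line_sq_exp_kernel[of 0 z p]], of "-1" p]
      by simp
    show "integrable lborel (\<lambda>u. indicator {0..} u * exp (- c * u))"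
      using hb by (simp add: has_bochner_integral_iff)
    show "(cmod (exp_kernel z p 0 (p - u)))\<^sup>2 \<le> indicator {0..} u * exp (- c * u)" for u
      by (auto simp: exp_kernel_def indicator_def c_def exp_double[symmetric])
  qed
  also have "\<dots> = 1 / c"
    using hb by (simp add: has_bochner_integral_iff)
  also have "\<dots> \<le> (1 / sqrt (Re z))\<^sup>2"
    using z by (simp add: c_def power_divide divide_simps)
  finally show "(norm (abs_l2 (exp_kernel z p 0)))\<^sup>2 \<le> (1 / sqrt (Re z))\<^sup>2" .
qed (use z in auto)

lemma pairing_exp_kernel_right_shift:
  assumes h: "0 \<le> h" "h \<le> p"
  shows "pairing (abs_l2 (exp_kernel z p 0)) (right_shift h x) = exp (z * of_real h) *
    (pairing (abs_l2 (exp_kernel z p 0)) x - pairing (abs_l2 (exp_kernel z p (p - h))) x)"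
proof -
  obtain f where f: "half_line_sq f" "x = abs_l2 f"
    by (rule l2_cases)
  have "pairing (abs_l2 (exp_kernel z p 0)) (right_shift h x) = (\<integral>s. exp_kernel z p 0 s * f (s - h) \<partial>lborel)"
    using f h by (simp add: right_shift_abs_l2 pairing_abs_l2 half_line_sq_shift half_line_sq_exp_kernel)
  also have "\<dots> = (\<integral>u. exp_kernel z p 0 (h + u) * f u \<partial>lborel)"
    using lborel_integral_real_affine[of 1 "\<lambda>s. exp_kernel z p 0 s * f (s - h)" h] by simp
  also have "\<dots> = (\<integral>u. exp (z * of_real h) * (exp_kernel z p 0 u * f u - exp_kernel z p (p - h) u * f u) \<partial>lborel)"
  proof (rule integral_discrete_difference[where X = "{p - h}"])
    fix u assume "u \<notin> {p - h}"
    then show "exp_kernel z p 0 (h + u) * f u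
        = exp (z * of_real h) * (exp_kernel z p 0 u * f u - exp_kernel z p (p - h) u * f u)"
      using h half_line_sqD(3)[OF f(1), of u]
      by (cases "u < 0") (auto simp: exp_kernel_def indicator_def exp_add[symmetric] algebra_simps)
  qed auto
  also have "\<dots> = exp (z * of_real h) *
    (pairing (abs_l2 (exp_kernel z p 0)) x - pairing (abs_l2 (exp_kernel z p (p - h))) x)"
    unfolding integral_mult_right_zero
    using f h by (subst Bochner_Integration.integral_diff)
       (simp_all add: integrable_mult_half_line_sq half_line_sq_exp_kernel pairing_abs_l2)
  finally show ?thesis .
qed

lemma cmod_exp_diff_le:
  assumes "Re v \<le> 0" "Re w \<le> 0"
  shows "cmod (exp v - exp w) \<le> cmod (v - w)"
proof -
  have "cmod (exp v - exp w) \<le> 1 * cmod (v - w)"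
  proof (rule field_differentiable_bound)
    show "convex {u. Re u \<le> 0}"
      by (rule convex_halfspace_Re_le)
    show "(exp has_field_derivative exp u) (at u within {u. Re u \<le> 0})" for u :: complex
      by (intro DERIV_subset[OF DERIV_exp]) simp
  qed (use assms in auto)
  then show ?thesis by simp
qed

lemma pairing_exp_kernel_diff_le:
  assumes z: "0 \<le> Re z" "0 \<le> Re w" and h: "0 < h" "h \<le> p"
  shows "cmod (pairing (abs_l2 (exp_kernel z p (p - h))) x - pairing (abs_l2 (exp_kernel w p (p - h))) x)
    \<le> cmod (z - w) * h * sqrt h * norm x"
proof -
  have sq: "half_line_sq (\<lambda>s. exp_kernel z p (p - h) s - exp_kernel w p (p - h) s)"
    using h by (intro half_line_sq_diff half_line_sq_exp_kernel) auto
  have "norm (abs_l2 (\<lambda>s. exp_kernel z p (p - h) s - exp_kernel w p (p - h) s))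
      \<le> (cmod (z - w) * h) * sqrt (p - (p - h))"
  proof (rule norm_abs_l2_le_interval[OF sq])
    fix s
    show "cmod (exp_kernel z p (p - h) s - exp_kernel w p (p - h) s) \<le> cmod (z - w) * h * indicator {p - h..p} s"
    proof (cases "s \<in> {p - h..p}")
      case True
      have "cmod (exp_kernel z p (p - h) s - exp_kernel w p (p - h) s)
          = cmod (exp (- z * of_real (p - s)) - exp (- w * of_real (p - s)))"
        using True by (simp add: exp_kernel_def)
      also have "\<dots> \<le> cmod (- z * of_real (p - s) - (- w * of_real (p - s)))"
        using True z by (intro cmod_exp_diff_le) (auto simp: mult_nonneg_nonneg)
      also have "- z * of_real (p - s) - (- w * of_real (p - s)) = (w - z) * of_real (p - s)"
        by (simp add: algebra_simps)
      also have "cmod ((w - z) * of_real (p - s)) = cmod (z - w) * (p - s)"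
        using True by (simp only: norm_mult norm_of_real norm_minus_commute[of w z]) simp
      also have "\<dots> \<le> cmod (z - w) * h"
        using True by (intro mult_left_mono) auto
      finally show ?thesis
        using True by simp
    next
      case False
      then show ?thesis
        by (simp add: exp_kernel_def)
    qed
  qed (use h in auto)
  then have "norm (abs_l2 (exp_kernel z p (p - h)) - abs_l2 (exp_kernel w p (p - h))) \<le> cmod (z - w) * h * sqrt h"
    using h by (simp add: abs_l2_diff half_line_sq_exp_kernel)
  then have "cmod (pairing (abs_l2 (exp_kernel z p (p - h)) - abs_l2 (exp_kernel w p (p - h))) x)
      \<le> cmod (z - w) * h * sqrt h * norm x"
    by (rule order_trans[OF cmod_pairing_le mult_right_mono]) simp
  then show ?thesis
    by (simp only: pairing.diff_left)
qed

lemma pairing_exp_kernel_average_tendsto: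
  assumes x: "((\<lambda>h. (right_shift h x - x) /\<^sub>R h) \<longlongrightarrow> y) (at_right 0)" and p: "0 < p"
  shows "((\<lambda>h. pairing (abs_l2 (exp_kernel z p (p - h))) x /\<^sub>R h)
    \<longlongrightarrow> pairing (abs_l2 (exp_kernel z p 0)) (z *\<^sub>C x - y)) (at_right 0)"
proof -
  let ?E = "pairing (abs_l2 (exp_kernel z p 0))"
  have "((\<lambda>h. exp (- z * of_real h) * (((exp (z * of_real h) - 1) /\<^sub>R h) * ?E x - ?E ((right_shift h x - x) /\<^sub>R h)))
      \<longlongrightarrow> exp (- z * of_real 0) * (z * ?E x - ?E y)) (at_right 0)"
    by (intro tendsto_mult tendsto_diff pairing.tendsto x exp_difference_quotient_tendsto tendsto_const
        tendsto_exp tendsto_of_real tendsto_ident_at)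
  moreover have "\<forall>\<^sub>F h in at_right 0.
      exp (- z * of_real h) * (((exp (z * of_real h) - 1) /\<^sub>R h) * ?E x - ?E ((right_shift h x - x) /\<^sub>R h))
      = pairing (abs_l2 (exp_kernel z p (p - h))) x /\<^sub>R h"
    unfolding eventually_at_right_field
  proof (intro exI[of _ p] conjI allI impI p)
    fix h assume h: "0 < h" "h < p"
    let ?J = "pairing (abs_l2 (exp_kernel z p (p - h))) x"
    have "((exp (z * of_real h) - 1) /\<^sub>R h) * ?E x - ?E ((right_shift h x - x) /\<^sub>R h)
        = exp (z * of_real h) * ?J /\<^sub>R h"
      using h by (simp add: pairing.scaleR_right pairing.diff_right pairing_exp_kernel_right_shift
          scaleR_conv_of_real algebra_simps)
    then show "exp (- z * of_real h) * (((exp (z * of_real h) - 1) /\<^sub>R h) * ?E x - ?E ((right_shift h x - x) /\<^sub>R h))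
        = ?J /\<^sub>R h"
      by (simp add: exp_minus)
  qed
  ultimately show ?thesis
    by (simp add: Lim_transform_eventually pairing_diff pairing_scaleC)
qed

text \<open>Both sides are the limit of the averages of \<open>x\<close> over \<open>[p - h, p]\<close>, that is, the value of
  \<open>x\<close> at \<open>p\<close>; this makes point evaluation well defined on classes.\<close>

lemma pairing_exp_kernel_eq:
  assumes x: "((\<lambda>h. (right_shift h x - x) /\<^sub>R h) \<longlongrightarrow> y) (at_right 0)" and p: "0 < p"
    and z: "0 \<le> Re z" "0 \<le> Re w"
  shows "pairing (abs_l2 (exp_kernel z p 0)) (z *\<^sub>C x - y) = pairing (abs_l2 (exp_kernel w p 0)) (w *\<^sub>C x - y)"
proof -
  let ?J = "\<lambda>z h. pairing (abs_l2 (exp_kernel z p (p - h))) x"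
  have "((\<lambda>h. ?J z h /\<^sub>R h - ?J w h /\<^sub>R h) \<longlongrightarrow> 0) (at_right 0)"
  proof (rule Lim_null_comparison)
    show "\<forall>\<^sub>F h in at_right 0. norm (?J z h /\<^sub>R h - ?J w h /\<^sub>R h) \<le> cmod (z - w) * norm x * sqrt h"
      unfolding eventually_at_right_field
    proof (intro exI[of _ p] conjI allI impI p)
      fix h assume h: "0 < h" "h < p"
      have "norm (?J z h /\<^sub>R h - ?J w h /\<^sub>R h) = norm (?J z h - ?J w h) / h"
        using h by (simp add: scaleR_diff_right[symmetric] divide_inverse mult.commute del: scaleR_diff_right)
      also have "\<dots> \<le> cmod (z - w) * h * sqrt h * norm x / h"
        using h z by (intro divide_right_mono pairing_exp_kernel_diff_le) auto
      also have "\<dots> = cmod (z - w) * norm x * sqrt h"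
        using h by simp
      finally show "norm (?J z h /\<^sub>R h - ?J w h /\<^sub>R h) \<le> cmod (z - w) * norm x * sqrt h" .
    qed
    have "((\<lambda>h. cmod (z - w) * norm x * sqrt h) \<longlongrightarrow> cmod (z - w) * norm x * sqrt 0) (at_right 0)"
      by (intro tendsto_intros)
    then show "((\<lambda>h. cmod (z - w) * norm x * sqrt h) \<longlongrightarrow> 0) (at_right 0)"
      by simp
  qed
  moreover have "((\<lambda>h. ?J z h /\<^sub>R h - ?J w h /\<^sub>R h) \<longlongrightarrow>
      pairing (abs_l2 (exp_kernel z p 0)) (z *\<^sub>C x - y) - pairing (abs_l2 (exp_kernel w p 0)) (w *\<^sub>C x - y)) (at_right 0)"
    by (intro tendsto_diff pairing_exp_kernel_average_tendsto x p)
  ultimately show ?thesis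
    using tendsto_unique[OF trivial_limit_at_right_real] by fastforce
qed


subsection \<open>The functional\<close>

lemma generator_eq:
  assumes "((\<lambda>h. (S h x - x) /\<^sub>R h) \<longlongrightarrow> y) (at_right 0)"
  shows "x \<in> gen_dom S" "generator S x = y"
  using assms by (auto simp: gen_dom_def generator_def intro: tendsto_Lim)

lemma generator_tendsto:
  assumes "x \<in> gen_dom S"
  shows "((\<lambda>h. (S h x - x) /\<^sub>R h) \<longlongrightarrow> generator S x) (at_right 0)"
  using assms generator_eq(2) by (fastforce simp: gen_dom_def)

lemma right_shift_generator_add:
  assumes "x \<in> gen_dom right_shift" "y \<in> gen_dom right_shift"
  shows "generator right_shift (x + y) = generator right_shift x + generator right_shift y"
proof (rule generator_eq(2), rule Lim_transform_eventually)
  show "((\<lambda>h. (right_shift h x - x) /\<^sub>R h + (right_shift h y - y) /\<^sub>R h)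
      \<longlongrightarrow> generator right_shift x + generator right_shift y) (at_right 0)"
    using assms by (intro tendsto_add generator_tendsto)
  show "\<forall>\<^sub>F h in at_right 0. (right_shift h x - x) /\<^sub>R h + (right_shift h y - y) /\<^sub>R h
      = (right_shift h (x + y) - (x + y)) /\<^sub>R h"
    unfolding eventually_at_right_field
    by (intro exI[of _ 1]) (auto simp: right_shift_add scaleR_add_right[symmetric] simp del: scaleR_add_right)
qed

lemma right_shift_generator_scaleC:
  assumes "x \<in> gen_dom right_shift"
  shows "generator right_shift (c *\<^sub>C x) = c *\<^sub>C generator right_shift x"
proof (rule generator_eq(2), rule Lim_transform_eventually)
  show "((\<lambda>h. c *\<^sub>C ((right_shift h x - x) /\<^sub>R h)) \<longlongrightarrow> c *\<^sub>C generator right_shift x) (at_right 0)"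
    using assms by (intro scaleC.tendsto tendsto_const generator_tendsto)
  show "\<forall>\<^sub>F h in at_right 0. c *\<^sub>C ((right_shift h x - x) /\<^sub>R h) = (right_shift h (c *\<^sub>C x) - c *\<^sub>C x) /\<^sub>R h"
    unfolding eventually_at_right_field
    by (intro exI[of _ 1]) (auto simp: right_shift_scaleC scaleC.scaleR_right scaleC_diff)
qed

lemma right_shift_generator_right_shift:
  assumes "x \<in> gen_dom right_shift" "0 \<le> t"
  shows "right_shift t x \<in> gen_dom right_shift"
    and "generator right_shift (right_shift t x) = right_shift t (generator right_shift x)"
proof -
  have "((\<lambda>h. (right_shift h (right_shift t x) - right_shift t x) /\<^sub>R h)
      \<longlongrightarrow> right_shift t (generator right_shift x)) (at_right 0)"
  proof (rule Lim_transform_eventually)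
    have "((\<lambda>h. norm ((right_shift h x - x) /\<^sub>R h - generator right_shift x)) \<longlongrightarrow> 0) (at_right 0)"
      using generator_tendsto[OF assms(1)] by (simp add: tendsto_norm_zero_iff Lim_null[symmetric])
    then have "((\<lambda>h. norm (right_shift t ((right_shift h x - x) /\<^sub>R h) - right_shift t (generator right_shift x)))
        \<longlongrightarrow> 0) (at_right 0)"
      using assms(2) by (simp add: right_shift_diff[symmetric] norm_right_shift)
    then show "((\<lambda>h. right_shift t ((right_shift h x - x) /\<^sub>R h)) \<longlongrightarrow> right_shift t (generator right_shift x)) (at_right 0)"
      by (simp add: tendsto_norm_zero_iff Lim_null[symmetric])
    show "\<forall>\<^sub>F h in at_right 0. right_shift t ((right_shift h x - x) /\<^sub>R h)
        = (right_shift h (right_shift t x) - right_shift t x) /\<^sub>R h"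
      unfolding eventually_at_right_field using assms(2)
      by (intro exI[of _ 1]) (auto simp: right_shift_scaleC right_shift_diff right_shift_commute
          scaleC_of_real[symmetric] simp del: of_real_inverse)
  qed
  then show "right_shift t x \<in> gen_dom right_shift"
    and "generator right_shift (right_shift t x) = right_shift t (generator right_shift x)"
    by (rule generator_eq)+
qed

lemma resolvent_right_shift:
  assumes "0 < Re z"
  defines "R \<equiv> resolvent (gen_dom right_shift) (generator right_shift) z"
  shows "R y \<in> gen_dom right_shift" "z *\<^sub>C R y - generator right_shift (R y) = y"
proof -
  obtain x where "((\<lambda>h. (right_shift h x - x) /\<^sub>R h) \<longlongrightarrow> z *\<^sub>C x - y) (at_right 0)"
    using assms(1) by (rule resolvent_equation_solvable)
  from generator_eq[where S = right_shift, OF this]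
  have y: "y \<in> (\<lambda>x. z *\<^sub>C x - generator right_shift x) ` gen_dom right_shift"
    by (intro image_eqI[of _ _ x]) simp_all
  show "R y \<in> gen_dom right_shift" "z *\<^sub>C R y - generator right_shift (R y) = y"
    using inv_into_into[OF y] f_inv_into_f[OF y] by (simp_all add: R_def resolvent_def)
qed

lemma geometric_min_sum_bound:
  fixes \<beta> \<gamma> \<sigma> :: real
  assumes \<beta>: "0 < \<beta>" and \<gamma>: "0 < \<gamma>" "\<beta> + \<gamma> = 1 / 2" and \<sigma>: "0 < \<sigma>"
  defines "r \<equiv> 2 powr - \<beta>" and "w \<equiv> 2 powr \<gamma>"
  shows "summable (\<lambda>k. r ^ k * min (sqrt (2 ^ k)) (1 / sqrt \<sigma>))"
    and "\<sigma> powr \<gamma> * (\<Sum>k. r ^ k * min (sqrt (2 ^ k)) (1 / sqrt \<sigma>)) \<le> w / (w - 1) + 1 / (1 - r)"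
proof -
  let ?m = "\<lambda>k. r ^ k * min (sqrt (2 ^ k)) (1 / sqrt \<sigma>)"
  have r: "0 < r" "r < 1"
    using \<beta> powr_less_mono[of "-\<beta>" 0 2] by (auto simp: r_def)
  have w: "1 < w"
    using \<gamma> powr_less_mono[of 0 \<gamma> 2] by (auto simp: w_def)
  have rw: "r * sqrt 2 = w"
  proof -
    have "\<gamma> = - \<beta> + 1 / 2"
      using \<gamma>(2) by simp
    then have "w = r * 2 powr (1 / 2)"
      by (simp only: r_def w_def powr_add)
    then show ?thesis
      by (simp add: powr_half_sqrt)
  qed
  have rp: "r ^ k = 2 powr (- \<beta> * k)" and wp: "w ^ k = 2 powr (\<gamma> * k)" for k :: nat
    by (simp_all add: r_def w_def powr_realpow[symmetric] powr_powr)
  have geo: "summable (\<lambda>k. r ^ k * (1 / sqrt \<sigma>))"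
    using r by (intro summable_mult2 summable_geometric) simp
  show sm: "summable ?m"
  proof (rule summable_comparison_test'[OF geo, of 0])
    fix k
    have "?m k \<le> r ^ k * (1 / sqrt \<sigma>)"
      using r by (intro mult_left_mono) auto
    moreover have "0 \<le> ?m k"
      using r \<sigma> by (intro mult_nonneg_nonneg) auto
    ultimately show "norm (?m k) \<le> r ^ k * (1 / sqrt \<sigma>)"
      by (simp only: real_norm_def abs_of_nonneg)
  qed
  define n where "n = (LEAST n. 1 / \<sigma> \<le> 2 ^ n)"
  have "\<exists>n. 1 / \<sigma> \<le> 2 ^ n"
    using real_arch_pow[of 2 "1 / \<sigma>"] by (auto intro: less_imp_le)
  then have n: "1 / \<sigma> \<le> 2 ^ n"
    unfolding n_def by (rule LeastI_ex)
  have n': "\<sigma> \<le> 2 powr - real (n - 1)" if "n \<noteq> 0"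
  proof -
    have "\<not> 1 / \<sigma> \<le> 2 ^ (n - 1)"
      using not_less_Least[of "n - 1" "\<lambda>n. 1 / \<sigma> \<le> 2 ^ n"] that by (simp add: n_def)
    then show ?thesis
      using \<sigma> by (simp add: powr_minus powr_realpow field_simps)
  qed
  have head: "\<sigma> powr \<gamma> * (\<Sum>k<n. ?m k) \<le> w / (w - 1)"
  proof (cases "n = 0")
    case True
    then show ?thesis using w by simp
  next
    case False
    have "(\<Sum>k<n. ?m k) \<le> (\<Sum>k<n. w ^ k)"
      unfolding rw[symmetric] power_mult_distrib real_sqrt_power[symmetric]
      using r by (intro sum_mono mult_left_mono) auto
    also have "\<dots> = (w ^ n - 1) / (w - 1)"
      using w by (simp add: geometric_sum)
    also have "\<dots> \<le> w ^ n / (w - 1)"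
      using w by (intro divide_right_mono) auto
    finally have "\<sigma> powr \<gamma> * (\<Sum>k<n. ?m k) \<le> (2 powr - real (n - 1)) powr \<gamma> * (w ^ n / (w - 1))"
      using n'[OF False] \<sigma> \<gamma> w r by (intro mult_mono powr_mono2) (auto intro!: sum_nonneg)
    also have "(2 powr - real (n - 1)) powr \<gamma> = w / w ^ n"
      unfolding wp using False
      by (simp add: w_def powr_powr powr_diff[symmetric] of_nat_diff algebra_simps)
    finally show ?thesis
      using w by simp
  qed
  have tail: "\<sigma> powr \<gamma> * (\<Sum>k. ?m (k + n)) \<le> 1 / (1 - r)"
  proof -
    have "(\<Sum>k. ?m (k + n)) \<le> (\<Sum>k. r ^ k * (r ^ n / sqrt \<sigma>))"
    proof (rule suminf_le)
      show "?m (k + n) \<le> r ^ k * (r ^ n / sqrt \<sigma>)" for k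
        using r \<sigma> by (simp add: power_add mult.assoc mult_left_mono divide_inverse)
      show "summable (\<lambda>k. ?m (k + n))"
        using sm by (rule summable_ignore_initial_segment)
      show "summable (\<lambda>k. r ^ k * (r ^ n / sqrt \<sigma>))"
        using r by (intro summable_mult2 summable_geometric) simp
    qed
    also have "\<dots> = 1 / (1 - r) * (r ^ n / sqrt \<sigma>)"
      using r by (subst suminf_mult2[symmetric]) (simp_all add: suminf_geometric summable_geometric)
    finally have "\<sigma> powr \<gamma> * (\<Sum>k. ?m (k + n)) \<le> \<sigma> powr \<gamma> * (1 / (1 - r) * (r ^ n / sqrt \<sigma>))"
      by (intro mult_left_mono) auto
    also have "\<dots> = 1 / (1 - r) * (r ^ n * \<sigma> powr - \<beta>)"
    proof -
      have "- \<beta> = \<gamma> - 1 / 2"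
        using \<gamma>(2) by simp
      then have "\<sigma> powr - \<beta> = \<sigma> powr \<gamma> / sqrt \<sigma>"
        using \<sigma> by (simp only: powr_diff powr_half_sqrt)
      then show ?thesis by simp
    qed
    also have "\<dots> \<le> 1 / (1 - r) * 1"
    proof (rule mult_left_mono)
      have "\<sigma> powr - \<beta> = (1 / \<sigma>) powr \<beta>"
        using \<sigma> by (simp add: powr_minus powr_divide inverse_eq_divide)
      also have "\<dots> \<le> (2 ^ n) powr \<beta>"
        using n \<sigma> \<beta> by (intro powr_mono2) auto
      also have "\<dots> = 1 / r ^ n"
        by (simp add: rp powr_realpow[symmetric] powr_powr powr_minus divide_inverse mult.commute)
      finally show "r ^ n * \<sigma> powr - \<beta> \<le> 1"
        using r by (simp add: field_simps)
    qed (use r in auto)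
    finally show ?thesis by simp
  qed
  show "\<sigma> powr \<gamma> * (\<Sum>k. ?m k) \<le> w / (w - 1) + 1 / (1 - r)"
    unfolding suminf_split_initial_segment[OF sm, of n]
    using head tail by (simp add: distrib_left)
qed

lemma pairing_exp_kernel_unit_interval:
  assumes "0 \<le> t"
  obtains b where "pairing (abs_l2 (exp_kernel 1 p 0)) (right_shift t (abs_l2 (\<lambda>s. indicator {0..1} s))) = of_real b"
    "0 \<le> b" "1 / 2 \<le> p - t \<Longrightarrow> p - t \<le> 1 \<Longrightarrow> exp (- 1) / 2 \<le> b"
proof -
  let ?f = "\<lambda>s :: real. indicator {0..1} s :: complex"
  let ?g = "\<lambda>s. indicator {0..p} s * exp (s - p) * indicator {0..1} (s - t)"
  have "(\<lambda>s. (cmod (?f s))\<^sup>2) = (\<lambda>s. (cmod (indicator {0..1} s *\<^sub>R (1::complex)))\<^sup>2)"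
    by (auto simp: indicator_def fun_eq_iff)
  then have "integrable lborel (\<lambda>s. (cmod (?f s))\<^sup>2)"
    using sq_integrable_on_interval[OF continuous_on_const, of 0 1 1] by (simp only:)
  then have f: "half_line_sq ?f"
    unfolding half_line_sq_def by (intro conjI) (assumption | simp)+
  have "pairing (abs_l2 (exp_kernel 1 p 0)) (right_shift t (abs_l2 ?f)) = (\<integral>s. exp_kernel 1 p 0 s * ?f (s - t) \<partial>lborel)"
    using assms f by (simp add: right_shift_abs_l2 pairing_abs_l2 half_line_sq_shift half_line_sq_exp_kernel)
  also have "\<dots> = (\<integral>s. of_real (?g s) \<partial>lborel)"
    by (intro Bochner_Integration.integral_cong)
       (auto simp: exp_kernel_def indicator_def exp_of_real[symmetric])
  also have "\<dots> = of_real (\<integral>s. ?g s \<partial>lborel)"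
    by (rule integral_complex_of_real)
  finally have eq: "pairing (abs_l2 (exp_kernel 1 p 0)) (right_shift t (abs_l2 ?f)) = of_real (\<integral>s. ?g s \<partial>lborel)" .
  have nonneg: "0 \<le> (\<integral>s. ?g s \<partial>lborel)"
    by (intro Bochner_Integration.integral_nonneg) (auto simp: indicator_def)
  have lower: "exp (- 1) / 2 \<le> (\<integral>s. ?g s \<partial>lborel)" if pt: "1 / 2 \<le> p - t" "p - t \<le> 1"
  proof -
    have "exp (- 1) / 2 \<le> exp (- 1) * (p - t)"
      using pt(1) by simp
    also have "\<dots> = (\<integral>s. exp (- 1) * indicator {t..p} s \<partial>lborel)"
      using pt by simp
    also have "\<dots> \<le> (\<integral>s. ?g s \<partial>lborel)"
    proof (rule integral_mono)
      show "integrable lborel (\<lambda>s. exp (- 1) * indicator {t..p} s :: real)"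
        using pt by (intro integrable_mult_right integrable_real_indicator) auto
      have "integrable lborel (\<lambda>s. indicator {0..p} s *\<^sub>R exp (s - p))"
        by (rule borel_integrable_compact) (auto intro!: continuous_intros)
      then show "integrable lborel ?g"
        by (rule Bochner_Integration.integrable_bound) (auto simp: indicator_def)
      show "exp (- 1) * indicator {t..p} s \<le> ?g s" for s
        using pt assms by (auto simp: indicator_def)
    qed
    finally show ?thesis .
  qed
  show ?thesis
    using that[OF eq nonneg lower] .
qed

lemma nn_integral_dyadic_ge:
  fixes f :: "real \<Rightarrow> real"
  assumes c: "0 \<le> c" and le: "\<And>k t. 2 ^ Suc k - 1 \<le> t \<Longrightarrow> t \<le> 2 ^ Suc k - 1 / 2 \<Longrightarrow> c \<le> f t"
  shows "ennreal (c * (real N / 2)) \<le> (\<integral>\<^sup>+t\<in>{0..}. ennreal (f t) \<partial>lborel)"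
proof -
  define I where "I k = {2 ^ Suc k - 1..2 ^ Suc k - 1 / 2 :: real}" for k :: nat
  have I_sets: "I k \<in> sets borel" for k
    by (simp add: I_def)
  have disj: "I i \<inter> I j = {}" if "i < j" for i j
  proof -
    have "(2::real) * 2 ^ i = 2 ^ Suc i"
      by simp
    also have "\<dots> \<le> 2 ^ j"
      using that by (intro power_increasing) auto
    finally have "(2::real) * 2 ^ i \<le> 2 ^ j" .
    moreover have "(1::real) \<le> 2 ^ i"
      by (rule one_le_power) simp
    ultimately have "(2::real) ^ Suc i - 1 / 2 < 2 ^ Suc j - 1"
      unfolding power_Suc by linarith
    then show ?thesis
      unfolding I_def by force
  qed
  have "disjoint_family_on I {..<N}"
    unfolding disjoint_family_on_def by (metis disj inf_commute linorder_neqE_nat)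
  then have "(\<Sum>k<N. emeasure lborel (I k)) = emeasure lborel (\<Union>k<N. I k)"
    by (intro sum_emeasure) (auto simp: I_sets)
  moreover have "(\<Sum>k<N. emeasure lborel (I k)) = ennreal (real N / 2)"
  proof -
    have "emeasure lborel (I k) = ennreal (1 / 2)" for k
      by (simp add: I_def)
    then have "(\<Sum>k<N. emeasure lborel (I k)) = (\<Sum>k<N. ennreal (1 / 2))"
      by simp
    also have "\<dots> = ennreal (\<Sum>k<N. 1 / 2)"
      by (rule sum_ennreal) simp
    finally show ?thesis
      by simp
  qed
  moreover have "ennreal (c * (real N / 2)) = ennreal c * ennreal (real N / 2)"
    using c by (intro ennreal_mult) auto
  ultimately have "ennreal (c * (real N / 2)) = (\<integral>\<^sup>+t. ennreal c * indicator (\<Union>k<N. I k) t \<partial>lborel)"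
    using I_sets by (subst nn_integral_cmult_indicator) auto
  also have "\<dots> \<le> (\<integral>\<^sup>+t\<in>{0..}. ennreal (f t) \<partial>lborel)"
  proof (rule nn_integral_mono)
    fix t
    show "ennreal c * indicator (\<Union>k<N. I k) t \<le> ennreal (f t) * indicator {0..} t"
    proof (cases "t \<in> (\<Union>k<N. I k)")
      case True
      then obtain k where t: "2 ^ Suc k - 1 \<le> t" "t \<le> 2 ^ Suc k - 1 / 2"
        by (auto simp: I_def)
      moreover have "(1::real) \<le> 2 ^ Suc k"
        by (rule one_le_power) simp
      ultimately have "0 \<le> t"
        by linarith
      with le[OF t] True show ?thesis
        by (simp add: ennreal_leI)
    qed simp
  qed
  finally show ?thesis .
qed

theorem theorem3p1:
  fixes \<alpha> :: real
  assumes "0 < \<alpha>" and "\<alpha> < 1"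
  defines "D \<equiv> gen_dom right_shift"
    and "A \<equiv> generator right_shift"
  shows "\<exists>C :: l2 \<Rightarrow> complex.
    graph_bounded_functional D A C \<and>
    bdd_above ((\<lambda>z. Re z powr ((1 - \<alpha>) / 2) * onorm (\<lambda>x. C (resolvent D A z x)))
      ` {z :: complex. 0 < Re z}) \<and>
    \<not> admissible \<alpha> right_shift C"
proof -
  define r :: real where "r = 2 powr - (\<alpha> / 2)"
  define K where "K z k = abs_l2 (exp_kernel z (2 ^ k) 0)" for z and k :: nat
  define L where "L y = (\<Sum>k. of_real (r ^ k) * pairing (K 1 k) y)" for y
  define C where "C x = L (x - A x)" for x
  have r: "0 < r" "r < 1"
    using assms powr_less_mono[of "- (\<alpha> / 2)" 0 2] by (auto simp: r_def)
  have term_le: "norm (of_real (r ^ k) * pairing (K 1 k) y) \<le> r ^ k * norm y" for k y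
  proof -
    have "norm (K 1 k) \<le> 1"
      using norm_exp_kernel_le_inverse_sqrt[of 1 "2 ^ k"] by (simp add: K_def)
    then have "cmod (pairing (K 1 k) y) \<le> 1 * norm y"
      by (intro order_trans[OF cmod_pairing_le] mult_right_mono) auto
    then show ?thesis
      using r by (simp add: norm_mult norm_power mult_left_mono)
  qed
  have geo: "summable (\<lambda>k. r ^ k * norm y)" for y :: l2
    using r by (intro summable_mult2 summable_geometric) simp
  have sm: "summable (\<lambda>k. of_real (r ^ k) * pairing (K 1 k) y)" for y
    using geo term_le by (rule summable_comparison_test'[where N = 0])
  have L_add: "L (x + y) = L x + L y" for x y
    unfolding L_def pairing_add distrib_left by (rule suminf_add[symmetric]) (rule sm)+
  have L_scale: "L (c *\<^sub>C x) = c * L x" for c x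
    unfolding L_def pairing_scaleC mult.left_commute[of _ c] by (rule suminf_mult) (rule sm)
  have L_bound: "cmod (L y) \<le> 1 / (1 - r) * norm y" for y
  proof -
    have "cmod (L y) \<le> (\<Sum>k. r ^ k * norm y)"
      unfolding L_def using term_le geo by (rule norm_suminf_le)
    also have "\<dots> = 1 / (1 - r) * norm y"
      using r by (subst suminf_mult2[symmetric]) (simp_all add: suminf_geometric summable_geometric)
    finally show ?thesis .
  qed

  have "graph_bounded_functional D A C"
    unfolding graph_bounded_functional_def
  proof (intro conjI ballI allI)
    fix x y assume xy: "x \<in> D" "y \<in> D"
    then have "x + y - A (x + y) = (x - A x) + (y - A y)"
      by (simp add: A_def D_def right_shift_generator_add)
    then show "C (x + y) = C x + C y"
      by (simp only: C_def L_add)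
  next
    fix c x assume x: "x \<in> D"
    then have "c *\<^sub>C x - A (c *\<^sub>C x) = c *\<^sub>C (x - A x)"
      by (simp add: A_def D_def right_shift_generator_scaleC scaleC_diff)
    then show "C (c *\<^sub>C x) = c * C x"
      by (simp only: C_def L_scale)
  next
    have "cmod (C x) \<le> 1 / (1 - r) * (norm x + norm (A x))" for x
      unfolding C_def
      by (rule order_trans[OF L_bound mult_left_mono[OF norm_triangle_ineq4]]) (use r in simp)
    then show "\<exists>K. \<forall>x\<in>D. cmod (C x) \<le> K * (norm x + norm (A x))"
      by blast
  qed

  moreover define B where "B = 2 powr ((1 - \<alpha>) / 2) / (2 powr ((1 - \<alpha>) / 2) - 1) + 1 / (1 - r)"
  have "Re z powr ((1 - \<alpha>) / 2) * onorm (\<lambda>y. C (resolvent D A z y)) \<le> B" if z: "0 < Re z" for z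
  proof -
    let ?m = "\<lambda>k. r ^ k * min (sqrt (2 ^ k)) (1 / sqrt (Re z))"
    have "0 < \<alpha> / 2" "0 < (1 - \<alpha>) / 2" "\<alpha> / 2 + (1 - \<alpha>) / 2 = 1 / 2"
      using assms(1,2) by (simp_all add: field_simps)
    note m = geometric_min_sum_bound[OF this z, folded r_def, folded B_def]
    have "norm (C (resolvent D A z y)) \<le> suminf ?m * norm y" for y
    proof -
      define x where "x = resolvent D A z y"
      have x: "x \<in> D" "z *\<^sub>C x - A x = y"
        using resolvent_right_shift[OF z] by (simp_all add: x_def D_def A_def)
      have "pairing (K 1 k) (x - A x) = pairing (K z k) y" for k
        using pairing_exp_kernel_eq[OF generator_tendsto[OF x(1)[unfolded D_def]], of "2 ^ k" 1 z] z x(2)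
        by (simp add: K_def A_def scaleC_one)
      then have C: "C x = (\<Sum>k. of_real (r ^ k) * pairing (K z k) y)"
        by (simp add: C_def L_def)
      have "cmod (C x) \<le> (\<Sum>k. ?m k * norm y)"
        unfolding C
      proof (rule norm_suminf_le)
        fix k
        have "norm (K z k) \<le> min (sqrt (2 ^ k)) (1 / sqrt (Re z))"
          using z norm_exp_kernel_le_sqrt[of z "2 ^ k"] norm_exp_kernel_le_inverse_sqrt[of z "2 ^ k"]
          by (simp add: K_def)
        then have "cmod (pairing (K z k) y) \<le> min (sqrt (2 ^ k)) (1 / sqrt (Re z)) * norm y"
          by (rule order_trans[OF cmod_pairing_le mult_right_mono]) simp
        then show "norm (of_real (r ^ k) * pairing (K z k) y) \<le> ?m k * norm y"
          using r by (simp add: norm_mult norm_power mult.assoc mult_left_mono)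
      qed (use m in \<open>intro summable_mult2\<close>)
      also have "\<dots> = suminf ?m * norm y"
        using m(1) by (rule suminf_mult2[symmetric])
      finally show ?thesis
        by (simp add: x_def)
    qed
    moreover have "0 \<le> suminf ?m"
      using m(1) r z by (intro suminf_nonneg) auto
    ultimately have "onorm (\<lambda>y. C (resolvent D A z y)) \<le> suminf ?m"
      by (intro onorm_bound)
    then show ?thesis
      using m(2) by (meson mult_left_mono order_trans powr_ge_zero)
  qed
  then have "bdd_above ((\<lambda>z. Re z powr ((1 - \<alpha>) / 2) * onorm (\<lambda>x. C (resolvent D A z x)))
      ` {z :: complex. 0 < Re z})"
    by (intro bdd_aboveI[of _ B]) auto

  moreover have "\<not> admissible \<alpha> right_shift C"
  proof
    assume "admissible \<alpha> right_shift C"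
    then obtain M where M: "\<And>x. x \<in> D \<Longrightarrow>
        (\<integral>\<^sup>+t\<in>{0..}. ennreal (t powr \<alpha> * (cmod (C (right_shift t x)))\<^sup>2) \<partial>lborel) \<le> ennreal (M\<^sup>2 * (norm x)\<^sup>2)"
      unfolding admissible_def D_def by blast
    define y where "y = abs_l2 (\<lambda>s. indicator {0..1} s)"
    define x where "x = resolvent D A 1 y"
    have x: "x \<in> D" "x - A x = y"
      using resolvent_right_shift[of 1 y] by (simp_all add: x_def D_def A_def scaleC_one)
    define e :: real where "e = exp (- 1) / 2"
    have e: "0 < e"
      by (simp add: e_def)
    have C_ge: "r ^ k * e \<le> cmod (C (right_shift t x))"
      if t: "0 \<le> t" "1 / 2 \<le> 2 ^ k - t" "2 ^ k - t \<le> 1" for t k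
    proof -
      have "\<exists>b. pairing (K 1 j) (right_shift t y) = of_real b \<and> 0 \<le> b \<and>
          (1 / 2 \<le> 2 ^ j - t \<longrightarrow> 2 ^ j - t \<le> 1 \<longrightarrow> e \<le> b)" for j
        unfolding K_def y_def e_def
        by (rule pairing_exp_kernel_unit_interval[OF t(1), of "2 ^ j"]) blast
      then obtain b where b: "\<And>j. pairing (K 1 j) (right_shift t y) = of_real (b j)" "\<And>j. 0 \<le> b j"
        "\<And>j. 1 / 2 \<le> 2 ^ j - t \<Longrightarrow> 2 ^ j - t \<le> 1 \<Longrightarrow> e \<le> b j"
        by metis
      have "C (right_shift t x) = L (right_shift t y)"
        using right_shift_generator_right_shift(2)[of x t] x t(1)
        by (simp add: C_def A_def D_def right_shift_diff[symmetric])
      also have "\<dots> = (\<Sum>j. of_real (r ^ j * b j))"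
        by (simp add: L_def b(1))
      finally have C: "C (right_shift t x) = (\<Sum>j. of_real (r ^ j * b j))" .
      have smb: "summable (\<lambda>j. r ^ j * b j)"
        using sm[of "right_shift t y"] unfolding b(1) of_real_mult[symmetric] summable_of_real_iff .
      have "r ^ k * e \<le> r ^ k * b k"
        using b(3)[OF t(2,3)] r by (intro mult_left_mono) auto
      also have "\<dots> \<le> (\<Sum>j. r ^ j * b j)"
        using sum_le_suminf[OF smb, of "{k}"] r b(2) by simp
      also have "\<dots> \<le> cmod (C (right_shift t x))"
        unfolding C suminf_of_real[OF smb, symmetric] by simp
      finally show ?thesis .
    qed
    have ge: "e\<^sup>2 / 2 \<le> t powr \<alpha> * (cmod (C (right_shift t x)))\<^sup>2"
      if t: "2 ^ Suc k - 1 \<le> t" "t \<le> 2 ^ Suc k - 1 / 2" for k t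
    proof -
      have "(1::real) \<le> 2 ^ k"
        by (rule one_le_power) simp
      then have t': "2 ^ k \<le> t"
        using t(1) unfolding power_Suc by linarith
      have "1 / 2 \<le> 2 powr (- \<alpha>)"
        using assms powr_mono[of "- 1" "- \<alpha>" 2] by (simp add: powr_minus)
      also have "\<dots> = (2 ^ k) powr \<alpha> * (r ^ Suc k)\<^sup>2"
        by (simp add: r_def powr_realpow[symmetric] powr_powr powr_add[symmetric] power_mult[symmetric]
            algebra_simps add_divide_distrib del: power_Suc)
      finally have "1 / 2 * e\<^sup>2 \<le> (2 ^ k) powr \<alpha> * (r ^ Suc k)\<^sup>2 * e\<^sup>2"
        by (rule mult_right_mono) simp
      also have "\<dots> = (2 ^ k) powr \<alpha> * (r ^ Suc k * e)\<^sup>2"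
        by (simp only: power_mult_distrib mult.assoc)
      also have "\<dots> \<le> t powr \<alpha> * (cmod (C (right_shift t x)))\<^sup>2"
      proof (rule mult_mono)
        show "(2 ^ k) powr \<alpha> \<le> t powr \<alpha>"
          using t' assms by (intro powr_mono2) auto
        have "0 \<le> t"
          using t' by (rule order_trans[rotated]) simp
        then show "(r ^ Suc k * e)\<^sup>2 \<le> (cmod (C (right_shift t x)))\<^sup>2"
          using t r e by (intro power_mono C_ge) auto
      qed auto
      finally show ?thesis by simp
    qed
    have "e\<^sup>2 / 2 * (real N / 2) \<le> M\<^sup>2 * (norm x)\<^sup>2" for N
    proof -
      have "ennreal (e\<^sup>2 / 2 * (real N / 2)) \<le> ennreal (M\<^sup>2 * (norm x)\<^sup>2)"
        by (rule order_trans[OF nn_integral_dyadic_ge[OF _ ge] M[OF x(1)]]) simp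
      then show ?thesis
        by (subst (asm) ennreal_le_iff) auto
    qed
    then have "real N \<le> M\<^sup>2 * (norm x)\<^sup>2 * 4 / e\<^sup>2" for N
      using e by (simp add: field_simps)
    then show False
      using reals_Archimedean2 not_le by blast
  qed
  ultimately show ?thesis
    by blast
qed

end
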